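(* Let $3\le m\le 5$ and let $\mathcal{A}$ be an $m$-homogeneous supersolvable line arrangement in the complex projective plane $\mathbb{P}^2$ which is not a pencil. Then $n_2\ge\frac{d}{2}$, where $d=|\mathcal{A}|$ and $n_2$ is the number of double points of $\mathcal{A}$.
   Context: A line arrangement in $\mathbb{P}^2$ is a finite set of distinct lines; it is a pencil if all its lines pass through one common point. An intersection point is a point lying on at least two lines of the arrangement; its multiplicity is the number of lines through it, and a double point is an intersection point of multiplicity exactly $2$. An intersection point $p$ is modular if for every other intersection point $q$ the line $\overline{pq}$ belongs to the arrangement. The arrangement is supersolvable if it has a modular point, and it is $m$-homogeneous supersolvable if it is supersolvable and all its modular points have the same multiplicity $m$. *)

theory Defs
  imports "HOL-Analysis.Analysis"
begin

text \<open>
  The complex projective plane is the projectivization of the vector space \<open>complex ^ 3\<close>: points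
  and lines are its linear subspaces, over the complex numbers, of dimension 1 and 2.  The
  qualifier \<open>vec\<close> selects the linear algebra of \<open>'a ^ 'n\<close> over its own scalar field; the
  unqualified \<open>subspace\<close>, \<open>span\<close> and \<open>dim\<close> would be those over the real numbers.
  A point lies on a line iff it is contained in it as a set.
\<close>

definition proj_point :: "(complex ^ 3) set \<Rightarrow> bool" where
  "proj_point p \<longleftrightarrow> vec.subspace p \<and> vec.dim p = 1"

definition proj_line :: "(complex ^ 3) set \<Rightarrow> bool" where
  "proj_line L \<longleftrightarrow> vec.subspace L \<and> vec.dim L = 2"

text \<open>For two distinct points this is the line joining them.\<close>

definition proj_join :: "(complex ^ 3) set \<Rightarrow> (complex ^ 3) set \<Rightarrow> (complex ^ 3) set" where
  "proj_join p q = vec.span (p \<union> q)"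

definition line_arrangement :: "(complex ^ 3) set set \<Rightarrow> bool" where
  "line_arrangement A \<longleftrightarrow> finite A \<and> (\<forall>L\<in>A. proj_line L)"

definition pencil :: "(complex ^ 3) set set \<Rightarrow> bool" where
  "pencil A \<longleftrightarrow> (\<exists>p. proj_point p \<and> (\<forall>L\<in>A. p \<subseteq> L))"

definition point_mult :: "(complex ^ 3) set set \<Rightarrow> (complex ^ 3) set \<Rightarrow> nat" where
  "point_mult A p = card {L \<in> A. p \<subseteq> L}"

definition intersection_points :: "(complex ^ 3) set set \<Rightarrow> (complex ^ 3) set set" where
  "intersection_points A = {p. proj_point p \<and> point_mult A p \<ge> 2}"

definition double_points :: "(complex ^ 3) set set \<Rightarrow> (complex ^ 3) set set" where
  "double_points A = {p \<in> intersection_points A. point_mult A p = 2}"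

definition modular_point :: "(complex ^ 3) set set \<Rightarrow> (complex ^ 3) set \<Rightarrow> bool" where
  "modular_point A p \<longleftrightarrow>
     p \<in> intersection_points A \<and>
     (\<forall>q\<in>intersection_points A. q \<noteq> p \<longrightarrow> proj_join p q \<in> A)"

definition supersolvable :: "(complex ^ 3) set set \<Rightarrow> bool" where
  "supersolvable A \<longleftrightarrow> (\<exists>p. modular_point A p)"

definition homogeneous_supersolvable :: "nat \<Rightarrow> (complex ^ 3) set set \<Rightarrow> bool" where
  "homogeneous_supersolvable m A \<longleftrightarrow>
     supersolvable A \<and> (\<forall>p. modular_point A p \<longrightarrow> point_mult A p = m)"

end

theory Submission
  imports Defs "HOL-Computational_Algebra.Polynomial"
begin

text \<open>
  Choose coordinates in which the modular point \<open>p\<close> is at vertical infinity and the line at infinity is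
  not in the arrangement.  The lines through \<open>p\<close> become \<open>x = a\<close> for \<open>a\<close> in a set \<open>I\<close> of size \<open>m\<close>,
  the others \<open>y = u x + v\<close> for \<open>(u, v)\<close> in a set \<open>S\<close>, and modularity says that any two lines of \<open>S\<close> meet
  over some \<open>a \<in> I\<close>.  Every \<open>a \<in> I\<close> thus partitions \<open>S\<close> into blocks of concurrent lines, two lines share a
  block for exactly one \<open>a\<close>, and the double points are the singleton blocks.

  If \<open>card S \<le> m\<close>, counting suffices.  Otherwise homogeneity forbids that all lines of \<open>S\<close> are concurrent,
  and a vector field of low degree tangent to all lines (the Redei-Szonyi bound on directions, in characteristic
  zero) shows that every nontrivial partition has \<open>n\<close> blocks with \<open>card S - m + 2 \<le> n < m\<close>.  This leaves
  \<open>(m, card S) \<in> {(4, 5), (5, 6), (5, 7)}\<close>, which are settled by counting, except for six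
  lines paired up by each of five directions; that configuration is excluded by a cubic with six roots.
\<close>

subsection \<open>Polynomials and tangent vector fields\<close>

text \<open>After dividing by the other factors, \<open>b\<close> is still a root, because in a
  domain the product of the factors \<open>b - b'\<close> is nonzero. Domain generality matters: the
  coefficients will themselves be polynomials in \<open>x\<close>, with roots
  \<open>lin j\<close>.\<close>

lemma prod_linear_dvd_if_roots:
  fixes p :: "'a::idom poly"
  assumes "finite B" "\<And>b. b \<in> B \<Longrightarrow> poly p b = 0"
  shows "(\<Prod>b\<in>B. [:-b, 1:]) dvd p"
  using assms
proof (induction B arbitrary: p rule: finite_induct)
  case (insert b B)
  then obtain q where q: "p = (\<Prod>b\<in>B. [:-b, 1:]) * q"
    by (metis dvdE insertCI)
  have "poly (\<Prod>b\<in>B. [:-b, 1:]) b \<noteq> 0"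
    using insert.hyps by (auto simp: poly_prod)
  then have "poly q b = 0"
    using insert.prems[of b] q by simp
  then show ?case
    using insert.hyps q by (metis dvd_refl mult_dvd_mono mult.commute poly_eq_0_iff_dvd prod.insert)
qed simp

text \<open>Orders of vanishing add under multiplication, and the product over the other roots has
  order 0 at \<open>b\<close>.\<close>

lemma prod_linear_power_dvd:
  fixes p :: "'a::idom poly"
  assumes "finite B" "\<And>b. b \<in> B \<Longrightarrow> [:-b, 1:] ^ n b dvd p"
  shows "(\<Prod>b\<in>B. [:-b, 1:] ^ n b) dvd p"
  using assms
proof (induction B arbitrary: p rule: finite_induct)
  case (insert b B)
  show ?case
  proof (cases "p = 0")
    case False
    let ?P = "\<Prod>b\<in>B. [:-b, 1:] ^ n b"
    obtain q where q: "p = ?P * q"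
      using insert by (metis dvdE insertCI)
    have "poly ?P b \<noteq> 0"
      using insert.hyps by (auto simp: poly_prod poly_power)
    then have "order b ?P = 0"
      by (rule order_0I)
    then have "order b p = order b q"
      using False q by (simp add: order_mult)
    then have "[:-b, 1:] ^ n b dvd q"
      using insert.prems[of b] False q by (auto simp: order_divides)
    then show ?thesis
      using insert.hyps q by (simp add: mult.commute mult_dvd_mono)
  qed simp
qed simp

lemma sum_card_fibres:
  assumes "finite S"
  shows "(\<Sum>c\<in>f ` S. card {x \<in> S. f x = c}) = card S"
  using sum.image_gen[OF assms, of "\<lambda>_. 1::nat" f] by simp

section \<open>Restricting a polynomial in \<open>x\<close> and \<open>y\<close> to the line
  \<open>x = a\<close>\<close>

lemma map_poly_poly_mult:
  fixes P Q :: "'a::comm_semiring_1 poly poly"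
  shows "map_poly (\<lambda>p. poly p a) (P * Q) = map_poly (\<lambda>p. poly p a) P * map_poly (\<lambda>p. poly p a) Q"
  by (intro poly_eqI) (simp add: coeff_map_poly coeff_mult poly_sum)

lemma map_poly_poly_diff:
  fixes P Q :: "'a::comm_ring_1 poly poly"
  shows "map_poly (\<lambda>p. poly p a) (P - Q) = map_poly (\<lambda>p. poly p a) P - map_poly (\<lambda>p. poly p a) Q"
  by (intro poly_eqI) (simp add: coeff_map_poly)

lemma map_poly_poly_prod:
  fixes P :: "'b \<Rightarrow> 'a::comm_semiring_1 poly poly"
  shows "map_poly (\<lambda>p. poly p a) (\<Prod>i\<in>B. P i) = (\<Prod>i\<in>B. map_poly (\<lambda>p. poly p a) (P i))"
  by (induction B rule: infinite_finite_induct) (simp_all add: map_poly_poly_mult)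

text \<open>A pair \<open>(u, v)\<close> stands for the line \<open>y = u x + v\<close>; \<open>ht a\<close> is its height over \<open>x = a\<close>.\<close>

definition ht :: "'a::comm_semiring_1 \<Rightarrow> 'a \<times> 'a \<Rightarrow> 'a" where
  "ht a j = fst j * a + snd j"

text \<open>In \<open>'a poly poly\<close> the inner variable is \<open>x\<close> and the outer one
  \<open>y\<close>, so \<open>poly G (lin j)\<close> restricts \<open>G\<close> to the line
  \<open>j\<close>.\<close>

definition lin :: "'a::comm_semiring_1 \<times> 'a \<Rightarrow> 'a poly" where
  "lin j = [:snd j, fst j:]"

definition dir_poly :: "'a::comm_ring_1 set \<Rightarrow> 'a poly" where
  "dir_poly I = (\<Prod>a\<in>I. [:-a, 1:])"

text \<open>Modularity in affine form. Over a ring it also forces distinct lines of \<open>S\<close>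
  to have distinct slopes.\<close>

definition meets_over :: "'a::comm_semiring_1 set \<Rightarrow> ('a \<times> 'a) set \<Rightarrow> bool" where
  "meets_over I S \<longleftrightarrow> (\<forall>j\<in>S. \<forall>k\<in>S. j \<noteq> k \<longrightarrow> (\<exists>a\<in>I. ht a j = ht a k))"

lemma poly_lin [simp]: "poly (lin j) a = ht a j"
  by (simp add: lin_def ht_def algebra_simps)

lemma lin_inject [simp]: "lin j = lin k \<longleftrightarrow> j = k"
  by (auto simp: lin_def prod_eq_iff)

lemma degree_lin: "degree (lin j) \<le> 1"
  by (simp add: lin_def)

lemma ht_eq_imp_lin_diff:
  fixes j k :: "'a::comm_ring_1 \<times> 'a"
  assumes "ht a j = ht a k"
  shows "lin j - lin k = smult (fst j - fst k) [:-a, 1:]"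
  using assms by (simp add: lin_def ht_def algebra_simps)

lemma ht_eq_unique:
  fixes j k :: "'a::idom \<times> 'a"
  assumes "j \<noteq> k" "ht a j = ht a k" "ht b j = ht b k"
  shows "a = b"
proof (rule ccontr)
  assume "a \<noteq> b"
  have "(fst j - fst k) * (a - b) = (ht a j - ht a k) - (ht b j - ht b k)"
    by (simp add: ht_def algebra_simps)
  also have "\<dots> = 0"
    using assms(2,3) by simp
  finally have "(fst j - fst k) * (a - b) = 0" .
  then have "fst j = fst k"
    using \<open>a \<noteq> b\<close> by simp
  then show False
    using assms(1,2) by (simp add: ht_def prod_eq_iff)
qed

text \<open>On a line of slope \<open>u\<close> through \<open>(a, c)\<close> one has
  \<open>y - c = u (x - a)\<close>, so \<open>(y - c) f / (x - a)\<close> takes the value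
  \<open>u f\<close> there, as \<open>G\<close> does. The difference has all these lines as roots in
  \<open>y\<close>.\<close>

lemma slope_interpolation_local:
  fixes I :: "'a::idom set" and G :: "'a poly poly"
  assumes "finite I" "a \<in> I" "finite B" "\<And>j. j \<in> B \<Longrightarrow> ht a j = c"
    and "\<And>j. j \<in> B \<Longrightarrow> poly G (lin j) = smult (fst j) (dir_poly I)"
  shows "(\<Prod>j\<in>B. [:- lin j, 1:]) dvd [:[:-c:], 1:] * [:dir_poly (I - {a}):] - G"
proof -
  have f: "dir_poly I = [:-a, 1:] * dir_poly (I - {a})"
    using assms(1,2) unfolding dir_poly_def by (simp add: prod.remove)
  have "poly ([:[:-c:], 1:] * [:dir_poly (I - {a}):] - G) (lin j) = 0" if "j \<in> B" for j
  proof -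
    have "lin j + [:-c:] = smult (fst j) [:-a, 1:]"
      using assms(4)[OF that] by (auto simp: lin_def ht_def algebra_simps)
    then have "(lin j + [:-c:]) * dir_poly (I - {a}) = smult (fst j) (dir_poly I)"
      by (simp only: f mult_smult_left)
    then show ?thesis
      using assms(5)[OF that] by (simp add: algebra_simps)
  qed
  then have "(\<Prod>z\<in>lin ` B. [:- z, 1:]) dvd [:[:-c:], 1:] * [:dir_poly (I - {a}):] - G"
    using assms(3) by (intro prod_linear_dvd_if_roots) auto
  then show ?thesis
    by (subst (asm) prod.reindex) (auto simp: inj_on_def)
qed

text \<open>
  \<open>f \<partial>\<^sub>x + G \<partial>\<^sub>y\<close> is a vector field tangent to all the lines; it is built by Newton interpolation.
  Adding a line changes \<open>G\<close> by a multiple of \<open>\<Prod>(y - lin j)\<close>, and the quotient is a polynomial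
  because near a point \<open>(a, c)\<close> the polynomial \<open>(y - c) f / (x - a)\<close> already has the required values on
  all lines through it.  Splitting off \<open>E = x\<^bsup>m-1\<^esup> y\<close> removes the terms of degree \<open>m\<close>,
  which gives the strict degree bound.
\<close>

lemma slope_interpolation:
  fixes I :: "'a::field set" and S :: "('a \<times> 'a) set"
  assumes "finite S" "finite I" "card I \<ge> 2" "meets_over I S"
  shows "\<exists>G :: 'a poly poly. degree G < card I \<and>
           (\<forall>j\<in>S. poly G (lin j) = smult (fst j) (dir_poly I))"
proof -
  let ?m = "card I" and ?f = "dir_poly I"
  define E :: "'a poly poly" where "E = [:0, monom 1 (?m - 1):]"
  have degf: "degree ?f = ?m"
    unfolding dir_poly_def by (simp add: degree_prod_sum_eq)
  have lcf: "coeff ?f ?m = 1"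
    unfolding degf[symmetric] by (simp add: dir_poly_def lead_coeff_prod)
  \<comment> \<open>\<open>f\<close> is monic of degree \<open>m\<close>, and \<open>E\<close>
    restricts to \<open>u x^m + v x^(m-1)\<close>, so the leading terms cancel.\<close>
  have top: "degree (smult u ?f - poly E (lin (u, v))) < ?m" for u v
  proof -
    have "degree (smult u ?f) \<le> ?m"
      using degf by (simp add: degree_smult_le)
    moreover have "degree (poly E (lin (u, v))) \<le> ?m"
      using degree_mult_le[of "lin (u,v)" "monom (1::'a) (?m - 1)"] degree_lin[of "(u,v)"] assms(3)
      by (simp add: E_def degree_monom_eq)
    moreover have "coeff (poly E (lin (u, v))) ?m = u"
    proof -
      have "poly E (lin (u, v)) = monom v (?m - 1) + monom u ?m"
      proof -
        have "lin (u, v) = monom v 0 + monom u 1"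
          by (simp add: lin_def monom_0 monom_Suc)
        then show ?thesis
          using assms(3) by (simp add: E_def distrib_right mult_monom)
      qed
      then show ?thesis using assms(3) by simp
    qed
    ultimately show ?thesis
      using degf lcf assms(3)
      by (intro degree_lessI) (auto simp: coeff_eq_0 le_less)
  qed
  \<comment> \<open>The induction controls the degree of \<open>G\<close> on every line
    \<open>l\<close>, not only on those of \<open>S\<close>, because the next line to be added needs
    it.\<close>
  have "\<exists>G :: 'a poly poly. degree G < ?m \<and> (\<forall>l. degree (poly G (lin l)) < ?m) \<and>
           (\<forall>j\<in>S. poly (G + E) (lin j) = smult (fst j) ?f)"
    using assms(1,4)
  proof (induction S rule: finite_induct)
    case empty
    show ?case using assms(3) by (intro exI[of _ 0]) auto
  next
    case (insert k S)
    then obtain G where G: "degree G < ?m" "\<And>l. degree (poly G (lin l)) < ?m"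
        "\<And>j. j \<in> S \<Longrightarrow> poly (G + E) (lin j) = smult (fst j) ?f"
      by (auto simp: meets_over_def)
    define F where "F = (\<Prod>j\<in>S. [:- lin j, 1:])"
    define D where "D = smult (fst k) ?f - poly (G + E) (lin k)"
    define B where "B a = {j \<in> S. ht a j = ht a k}" for a
    have Seq: "S = (\<Union>a\<in>I. B a)"
      using insert.prems insert.hyps by (auto simp: B_def meets_over_def)
    have Bdis: "B a \<inter> B b = {}" if "a \<noteq> b" for a b
    proof -
      have False if "j \<in> B a" "j \<in> B b" for j
        using that \<open>a \<noteq> b\<close> insert.hyps(2) ht_eq_unique[of j k a b] by (auto simp: B_def)
      then show ?thesis by blast
    qed
    have finB: "finite (B a)" for a
      using insert.hyps by (simp add: B_def)
    \<comment> \<open>Up to a unit: lines with equal slope and equal height over \<open>a\<close>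
      would coincide, so no slope difference is zero.\<close>
    have fac: "\<exists>e. e \<noteq> 0 \<and> (\<Prod>j\<in>B a. lin k - lin j) = smult e ([:-a, 1:] ^ card (B a))" for a
    proof -
      have "(\<Prod>j\<in>B a. lin k - lin j) = (\<Prod>j\<in>B a. smult (fst k - fst j) [:-a, 1:])"
        by (intro prod.cong refl ht_eq_imp_lin_diff) (simp add: B_def)
      also have "\<dots> = smult (\<Prod>j\<in>B a. fst k - fst j) ([:-a, 1:] ^ card (B a))"
        by (simp only: prod_smult prod_constant)
      finally show ?thesis
        using insert.hyps finB
        by (intro exI[of _ "\<Prod>j\<in>B a. fst k - fst j"]) (auto simp: B_def ht_def prod_eq_iff)
    qed
    \<comment> \<open>\<open>W\<close> is divisible by the product over \<open>B a\<close>, and its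
      value on the line \<open>k\<close> is the defect \<open>D\<close>, since \<open>k\<close> also
      passes through the point of height \<open>ht a k\<close> over \<open>a\<close>.\<close>
    have local: "(\<Prod>j\<in>B a. lin k - lin j) dvd D" if "a \<in> I" for a
    proof -
      define W where "W = [:[:- ht a k:], 1:] * [:dir_poly (I - {a}):] - (G + E)"
      have "(\<Prod>j\<in>B a. [:- lin j, 1:]) dvd W"
        unfolding W_def using assms(2) that finB
      proof (rule slope_interpolation_local)
        show "ht a j = ht a k" "poly (G + E) (lin j) = smult (fst j) ?f" if "j \<in> B a" for j
          using that G(3) by (auto simp: B_def)
      qed
      then obtain Q where Q: "W = (\<Prod>j\<in>B a. [:- lin j, 1:]) * Q" ..
      have f: "?f = [:-a, 1:] * dir_poly (I - {a})"
        using assms(2) that unfolding dir_poly_def by (simp add: prod.remove)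
      have "lin k + [:- ht a k:] = smult (fst k) [:-a, 1:]"
        by (auto simp: lin_def ht_def algebra_simps)
      then have "(lin k + [:- ht a k:]) * dir_poly (I - {a}) = smult (fst k) ?f"
        by (simp only: f mult_smult_left)
      then have "D = poly W (lin k)"
        by (simp add: D_def W_def algebra_simps)
      then show ?thesis
        unfolding Q by (simp add: poly_prod)
    qed
    have "(\<Prod>a\<in>I. [:-a, 1:] ^ card (B a)) dvd D"
    proof (rule prod_linear_power_dvd[OF assms(2)])
      fix a assume "a \<in> I"
      then show "[:-a, 1:] ^ card (B a) dvd D"
        using local[of a] fac[of a] by (metis smult_dvd_cancel)
    qed
    moreover have "poly F (lin k) = (\<Prod>a\<in>I. \<Prod>j\<in>B a. lin k - lin j)"
    proof -
      have "poly F (lin k) = (\<Prod>j\<in>(\<Union>a\<in>I. B a). lin k - lin j)"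
        using Seq by (simp add: F_def poly_prod)
      then show ?thesis
        using assms(2) finB Bdis by (simp add: prod.UNION_disjoint)
    qed
    moreover have "(\<Prod>a\<in>I. \<Prod>j\<in>B a. lin k - lin j) dvd (\<Prod>a\<in>I. [:-a, 1:] ^ card (B a))"
    proof (rule prod_dvd_prod)
      fix a
      show "(\<Prod>j\<in>B a. lin k - lin j) dvd [:-a, 1:] ^ card (B a)"
        using fac[of a] smult_dvd[OF dvd_refl] by metis
    qed
    ultimately have "poly F (lin k) dvd D"
      by (metis dvd_trans)
    then obtain q where q: "D = poly F (lin k) * q" ..
    have degF: "degree F = card S"
      unfolding F_def by (simp add: degree_prod_sum_eq)
    have F0: "poly F (lin k) \<noteq> 0"
      using insert.hyps by (auto simp: F_def poly_prod)
    have degFk: "degree (poly F (lin k)) = card S"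
    proof -
      have "degree (lin k - lin j) = 1" if jS: "j \<in> S" for j
      proof -
        have "j \<noteq> k"
          using jS insert.hyps by blast
        then obtain a where "ht a k = ht a j"
          using insert.prems jS by (auto simp: meets_over_def)
        moreover from this \<open>j \<noteq> k\<close> have "fst k \<noteq> fst j"
          by (auto simp: ht_def prod_eq_iff)
        ultimately show ?thesis
          by (simp add: ht_eq_imp_lin_diff)
      qed
      then show ?thesis
        using insert.hyps by (simp add: F_def poly_prod) (subst degree_prod_sum_eq, auto)
    qed
    have "D = (smult (fst k) ?f - poly E (lin k)) - poly G (lin k)"
      by (simp add: D_def)
    then have degD: "degree D < ?m"
      using top[of "fst k" "snd k"] G(2)[of k] by (simp add: degree_diff_less)
    \<comment> \<open>Here \<open>D = poly F (lin k) * q\<close> with \<open>poly F (lin k)\<close>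
      of exact degree \<open>card S\<close>. Once \<open>card S\<close> reaches \<open>m\<close>
      this forces \<open>q = 0\<close>, so the interpolant no longer changes.\<close>
    have degq: "q = 0 \<or> degree q + card S < ?m"
      using degD F0 degFk unfolding q by (cases "q = 0") (auto simp: degree_mult_eq add.commute)
    define G' where "G' = G + smult q F"
    have "degree G' < ?m"
      using G(1) degq degF unfolding G'_def by (auto intro!: degree_add_less simp: degree_smult_eq)
    moreover have "degree (poly G' (lin l)) < ?m" for l
    proof -
      have "degree (poly F (lin l)) \<le> card S"
      proof -
        have "degree (poly F (lin l)) \<le> (\<Sum>j\<in>S. degree (lin l - lin j))"
          using degree_prod_sum_le[OF insert.hyps(1), of "\<lambda>j. lin l - lin j"]
          by (simp add: F_def poly_prod o_def)
        also have "\<dots> \<le> (\<Sum>j\<in>S. 1)"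
          by (intro sum_mono degree_diff_le degree_lin)
        finally show ?thesis by simp
      qed
      then have "q = 0 \<or> degree (q * poly F (lin l)) < ?m"
        using degq degree_mult_le[of q "poly F (lin l)"] by linarith
      then show ?thesis
        using G(2)[of l] by (auto simp: G'_def degree_add_less)
    qed
    moreover have "poly (G' + E) (lin j) = smult (fst j) ?f" if "j \<in> insert k S" for j
    proof (cases "j = k")
      case True
      then show ?thesis using q by (simp add: G'_def D_def algebra_simps)
    next
      case False
      then have "poly F (lin j) = 0"
        using that insert.hyps by (auto simp: F_def poly_prod)
      then show ?thesis
        using False that G(3)[of j] by (simp add: G'_def algebra_simps)
    qed
    ultimately show ?case by blast
  qed
  then obtain G :: "'a poly poly" where "degree G < ?m" "\<forall>j\<in>S. poly (G + E) (lin j) = smult (fst j) ?f"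
    by blast
  moreover have "degree E < ?m"
    using assms(3) by (simp add: E_def)
  ultimately show ?thesis
    by (intro exI[of _ "G + E"]) (auto simp: degree_add_less)
qed

text \<open>
  Restricting \<open>G\<close> to \<open>x = a\<close> gives a polynomial \<open>h\<close> of degree below \<open>card I\<close> that agrees, up to a constant
  factor, with \<open>y - c\<close> to order \<open>b\<close> at each point \<open>c\<close> where \<open>b\<close> lines meet.  The two bounds count the zeros
  of \<open>h\<close> and of its derivative minus that constant.
\<close>

lemma direction_bounds:
  fixes I :: "'a::field_char_0 set" and S :: "('a \<times> 'a) set"
  assumes "finite S" "finite I" "meets_over I S" "a \<in> I"
    and "card (ht a ` S) \<ge> 2" "card (ht a ` S) < card S"
  shows "card (ht a ` S) < card I" "card S + 2 \<le> card (ht a ` S) + card I"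
proof -
  \<comment> \<open>If \<open>a\<close> were the only direction, all lines would meet over it and
    form one block.\<close>
  have "I \<noteq> {a}"
  proof
    assume "I = {a}"
    then have "ht a j = ht a k" if "j \<in> S" "k \<in> S" for j k
      using assms(3) that by (auto simp: meets_over_def)
    then have "\<forall>x\<in>ht a ` S. \<forall>y\<in>ht a ` S. x = y"
      by blast
    then have "card (ht a ` S) \<le> Suc 0"
      using assms(1) card_le_Suc0_iff_eq[of "ht a ` S"] by blast
    then show False using assms(5) by simp
  qed
  then obtain b where "b \<in> I" "b \<noteq> a"
    using assms(4) by blast
  then have m2: "card I \<ge> 2"
    using assms(2,4) card_mono[of I "{a, b}"] by auto
  obtain G :: "'a poly poly" where G: "degree G < card I"
      "\<And>j. j \<in> S \<Longrightarrow> poly G (lin j) = smult (fst j) (dir_poly I)"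
    using slope_interpolation[OF assms(1,2) m2 assms(3)] by blast
  define h where "h = map_poly (\<lambda>p. poly p a) G"
  define \<kappa> where "\<kappa> = poly (dir_poly (I - {a})) a"
  define B where "B c = {j \<in> S. ht a j = c}" for c
  have \<kappa>: "\<kappa> \<noteq> 0"
    using assms(2) by (auto simp: \<kappa>_def dir_poly_def poly_prod)
  have degh: "degree h < card I"
    using G(1) map_poly_degree_leq[of "\<lambda>p. poly p a" G] by (simp add: h_def)
  \<comment> \<open>On \<open>x = a\<close> all factors \<open>y - lin j\<close> with
    \<open>j\<close> in \<open>B c\<close> become \<open>y - c\<close>, which turns the local
    divisibility into a multiplicity.\<close>
  have dvd: "[:-c, 1:] ^ card (B c) dvd smult \<kappa> [:-c, 1:] - h" for c
  proof -
    define W where "W = [:[:-c:], 1:] * [:dir_poly (I - {a}):] - G"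
    have "(\<Prod>j\<in>B c. [:- lin j, 1:]) dvd W"
      unfolding W_def using assms(2,4)
    proof (rule slope_interpolation_local)
      show "finite (B c)"
        using assms(1) by (simp add: B_def)
      show "ht a j = c" "poly G (lin j) = smult (fst j) (dir_poly I)" if "j \<in> B c" for j
        using that G(2) by (auto simp: B_def)
    qed
    then obtain Q where "W = (\<Prod>j\<in>B c. [:- lin j, 1:]) * Q" ..
    then have "map_poly (\<lambda>p. poly p a) W =
        (\<Prod>j\<in>B c. [:- ht a j, 1:]) * map_poly (\<lambda>p. poly p a) Q"
      by (simp add: map_poly_poly_mult map_poly_poly_prod map_poly_pCons)
    also have "(\<Prod>j\<in>B c. [:- ht a j, 1:]) = [:-c, 1:] ^ card (B c)"
      by (simp add: B_def)
    finally have "[:-c, 1:] ^ card (B c) dvd map_poly (\<lambda>p. poly p a) W" by simp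
    moreover have "map_poly (\<lambda>p. poly p a) W = smult \<kappa> [:-c, 1:] - h"
      by (simp add: W_def h_def \<kappa>_def map_poly_poly_diff map_poly_pCons mult.commute)
    ultimately show ?thesis by simp
  qed
  have sumB: "(\<Sum>c\<in>ht a ` S. card (B c)) = card S"
    unfolding B_def using assms(1) by (rule sum_card_fibres)
  have B1: "card (B c) \<ge> 1" if "c \<in> ht a ` S" for c
    using that assms(1) by (auto simp: B_def Suc_le_eq card_gt_0_iff)
  have root: "poly h c = 0" if "c \<in> ht a ` S" for c
  proof -
    have "[:-c, 1:] dvd smult \<kappa> [:-c, 1:] - h"
      using dvd[of c] B1[OF that] by (metis dvd_trans le_imp_power_dvd power_one_right)
    then show ?thesis
      by (simp add: poly_eq_0_iff_dvd[symmetric])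
  qed
  \<comment> \<open>If \<open>h = 0\<close>, then \<open>(y - c)^b\<close> divides a nonzero
    multiple of \<open>y - c\<close>, so all blocks are singletons, against the last
    assumption.\<close>
  have "h \<noteq> 0"
  proof
    assume "h = 0"
    have "card (B c) \<le> 1" for c
    proof (rule ccontr)
      assume "\<not> card (B c) \<le> 1"
      then have "[:-c, 1:] ^ 2 dvd [:-c, 1:] ^ card (B c)"
        by (intro le_imp_power_dvd) simp
      also have "\<dots> dvd smult \<kappa> [:-c, 1:]"
        using dvd[of c] \<open>h = 0\<close> by (simp only: diff_zero)
      finally have "[:-c, 1:] ^ 2 dvd smult \<kappa> [:-c, 1:]" .
      then have "degree ([:-c, 1:] ^ 2) \<le> degree (smult \<kappa> [:-c, 1:])"
        using \<kappa> by (intro dvd_imp_degree_le) auto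
      then show False
        using \<kappa> by (simp add: degree_power_eq)
    qed
    then have "(\<Sum>c\<in>ht a ` S. card (B c)) \<le> (\<Sum>c\<in>ht a ` S. 1)"
      by (intro sum_mono)
    then show False
      using sumB assms(6) by simp
  qed
  have blocks_le: "card (ht a ` S) \<le> degree h"
  proof -
    have "card (ht a ` S) \<le> card {c. poly h c = 0}"
      using root by (intro card_mono poly_roots_finite \<open>h \<noteq> 0\<close>) blast
    also have "\<dots> \<le> degree h"
      by (rule card_poly_roots_bound) fact
    finally show ?thesis .
  qed
  then show "card (ht a ` S) < card I"
    using degh by simp
  \<comment> \<open>In characteristic zero a constant derivative means degree at most 1, but
    \<open>h\<close> has at least two roots.\<close>
  have nz: "[:\<kappa>:] - pderiv h \<noteq> 0"
  proof
    assume "[:\<kappa>:] - pderiv h = 0"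
    then have "pderiv h = [:\<kappa>:]" by simp
    then have "degree (pderiv h) = 0" by simp
    then show False
      using blocks_le assms(5) by (simp add: degree_pderiv)
  qed
  have "[:-c, 1:] ^ (card (B c) - 1) dvd [:\<kappa>:] - pderiv h" for c
  proof (cases "card (B c)")
    case (Suc n)
    obtain q where q: "smult \<kappa> [:-c, 1:] - h = [:-c, 1:] ^ Suc n * q"
      using dvd[of c] Suc by (metis dvdE)
    have "[:\<kappa>:] - pderiv h = pderiv (smult \<kappa> [:-c, 1:] - h)"
      by (simp add: pderiv_diff pderiv_smult pderiv_pCons)
    also have "\<dots> = [:-c, 1:] ^ Suc n * pderiv q + q * (smult (of_nat (Suc n)) ([:-c, 1:] ^ n) * pderiv [:-c, 1:])"
      unfolding q by (simp only: pderiv_mult pderiv_power_Suc)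
    finally show ?thesis
      using Suc by (simp add: dvd_add dvd_mult dvd_smult del: mult_pCons_left mult_pCons_right)
  qed simp
  then have "(\<Prod>c\<in>ht a ` S. [:-c, 1:] ^ (card (B c) - 1)) dvd [:\<kappa>:] - pderiv h"
    using assms(1) by (intro prod_linear_power_dvd) auto
  then have "degree (\<Prod>c\<in>ht a ` S. [:-c, 1:] ^ (card (B c) - 1)) \<le> degree ([:\<kappa>:] - pderiv h)"
    using nz by (rule dvd_imp_degree_le)
  also have "\<dots> \<le> card I - 2"
    using degh degree_diff_le[of "[:\<kappa>:]" "card I - 2" "pderiv h"] degree_pderiv[of h] by simp
  finally have "(\<Sum>c\<in>ht a ` S. card (B c) - 1) \<le> card I - 2"
    by (subst (asm) degree_prod_sum_eq) (auto simp: degree_power_eq)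
  moreover have "(\<Sum>c\<in>ht a ` S. card (B c) - 1) = card S - card (ht a ` S)"
    using B1 sumB by (subst sum_subtractf_nat) auto
  ultimately show "card S + 2 \<le> card (ht a ` S) + card I"
    using m2 by linarith
qed

text \<open>
  If every block has two elements, the cubic \<open>\<Prod>(y - c)\<close> over the three blocks has coefficients
  that are polynomials in the power sums of the heights, hence polynomials of degree at most 3 in
  the direction.  It therefore vanishes identically on all six lines.
\<close>

lemma no_six_lines_in_pairs:
  fixes I :: "'a::field_char_0 set" and S :: "('a \<times> 'a) set"
  assumes "card S = 6" "finite I" "card I \<ge> 4"
    and pairs: "\<And>a j. a \<in> I \<Longrightarrow> j \<in> S \<Longrightarrow> card {k \<in> S. ht a k = ht a j} = 2"
  shows False
proof -
  have fin: "finite S"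
    using assms(1) by (metis card.infinite zero_neq_numeral)
  \<comment> \<open>Over a direction in \<open>I\<close> each height occurs twice, so halving yields
    the power sums of the three heights; \<open>e2\<close> and \<open>e3\<close> are then elementary
    symmetric by Newton's identities.\<close>
  define P where "P n = smult (1/2) (\<Sum>j\<in>S. lin j ^ n)" for n
  define e2 where "e2 = smult (1/2) (P 1 ^ 2 - P 2)"
  define e3 where "e3 = smult (1/6) (P 1 ^ 3 - 3 * P 1 * P 2 + 2 * P 3)"
  define N where "N = [:- e3, e2, - P 1, 1:]"
  have degl: "degree (lin j ^ n) \<le> n" for j :: "'a \<times> 'a" and n
    using degree_power_le[of "lin j" n] degree_lin[of j] by (metis le_trans mult_le_mono1 mult_1)
  have degP: "degree (P n) \<le> n" for n
    unfolding P_def using degl fin by (intro order.trans[OF degree_smult_le] degree_sum_le) auto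
  have degm: "degree (p * q) \<le> i + k" if "degree p \<le> i" "degree q \<le> k" for p q :: "'a poly" and i k
    using degree_mult_le[of p q] that by linarith
  have degP12: "degree (P 1 ^ n) \<le> n" for n
    using degree_power_le[of "P 1" n] degP[of 1] by (metis le_trans mult_le_mono1 mult_1)
  have dege2: "degree e2 \<le> 2"
    unfolding e2_def by (intro order.trans[OF degree_smult_le] degree_diff_le degP degP12)
  have dege3: "degree e3 \<le> 3"
  proof -
    have "degree (3 * P 1 * P 2) \<le> 3"
      using degm[OF degm[of 3 0 "P 1" 1] degP[of 2]] degP[of 1] by simp
    moreover have "degree (2 * P 3) \<le> 3"
      using degm[of 2 0 "P 3" 3] degP[of 3] by simp
    ultimately show ?thesis
      unfolding e3_def by (intro order.trans[OF degree_smult_le] degree_add_le degree_diff_le degP12)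
  qed
  have Nl: "poly N (lin j) = lin j ^ 3 - P 1 * lin j ^ 2 + e2 * lin j - e3" for j
    by (simp add: N_def algebra_simps power2_eq_square power3_eq_cube)
  have "poly N (lin j) = 0" if "j \<in> S" for j
  proof (rule ccontr)
    assume nz: "poly N (lin j) \<noteq> 0"
    have "degree (poly N (lin j)) \<le> 3"
      unfolding Nl
      using degl[of j 3] degm[OF degP[of 1] degl[of j 2]] degm[OF dege2 degree_lin[of j]] dege3
      by (intro degree_diff_le degree_add_le) auto
    moreover have "poly (poly N (lin j)) a = 0" if "a \<in> I" for a
    proof -
      have "(\<Sum>c\<in>ht a ` S. 2) = (\<Sum>c\<in>ht a ` S. card {k \<in> S. ht a k = c})"
        by (intro sum.cong) (auto simp: pairs[OF that])
      also have "\<dots> = card S"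
        using fin by (rule sum_card_fibres)
      finally have "card (ht a ` S) = 3"
        using assms(1) by simp
      then obtain c1 c2 c3 where c: "ht a ` S = {c1, c2, c3}" "c1 \<noteq> c2" "c1 \<noteq> c3" "c2 \<noteq> c3"
        by (metis card_3_iff)
      have Pa: "poly (P n) a = c1 ^ n + c2 ^ n + c3 ^ n" for n
      proof -
        have "(\<Sum>k\<in>S. ht a k ^ n) = (\<Sum>c\<in>ht a ` S. \<Sum>k\<in>{k \<in> S. ht a k = c}. ht a k ^ n)"
          using fin by (rule sum.image_gen)
        also have "\<dots> = (\<Sum>c\<in>ht a ` S. 2 * c ^ n)"
          by (intro sum.cong) (auto simp: pairs[OF that])
        also have "\<dots> = 2 * (c1 ^ n + c2 ^ n + c3 ^ n)"
          using c by (simp add: algebra_simps)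
        finally show ?thesis
          by (simp add: P_def poly_sum)
      qed
      have "poly (poly N (lin j)) a = (ht a j - c1) * (ht a j - c2) * (ht a j - c3)"
        unfolding Nl by (simp add: e2_def e3_def Pa field_simps power2_eq_square power3_eq_cube)
      then show ?thesis
        using c(1) \<open>j \<in> S\<close> by auto
    qed
    \<comment> \<open>Four roots are too many for a nonzero polynomial in \<open>x\<close> of degree
      at most 3. The cubic \<open>N\<close> in \<open>y\<close> then has the six roots
      \<open>lin j\<close>.\<close>
    then have "card I \<le> card {a. poly (poly N (lin j)) a = 0}"
      by (intro card_mono poly_roots_finite[OF nz]) auto
    ultimately show False
      using card_poly_roots_bound[OF nz] assms(3) by linarith
  qed
  then have "lin ` S \<subseteq> {z. poly N z = 0}" by auto
  moreover have "N \<noteq> 0" "degree N = 3"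
    by (simp_all add: N_def)
  ultimately have "card (lin ` S) \<le> 3"
    using card_poly_roots_bound[of N] poly_roots_finite[of N] by (metis card_mono le_trans)
  moreover have "card (lin ` S) = card S"
    by (intro card_image) (auto simp: inj_on_def)
  ultimately show False
    using assms(1) by simp
qed

subsection \<open>Counting singleton blocks\<close>

text \<open>Indexing blocks by a line instead of a height makes the sum of block sizes over
  \<open>S\<close> a sum of squares over the blocks.\<close>

definition block :: "('a::comm_semiring_1 \<times> 'a) set \<Rightarrow> 'a \<Rightarrow> 'a \<times> 'a \<Rightarrow> ('a \<times> 'a) set" where
  "block S a j = {k \<in> S. ht a k = ht a j}"

definition singles :: "('a::comm_semiring_1 \<times> 'a) set \<Rightarrow> 'a \<Rightarrow> ('a \<times> 'a) set" where
  "singles S a = {j \<in> S. card (block S a j) = 1}"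

lemma finite_block [simp]: "finite S \<Longrightarrow> finite (block S a j)"
  by (simp add: block_def)

lemma card_block_pos:
  assumes "finite S" "j \<in> S"
  shows "card (block S a j) \<ge> 1"
proof -
  have "j \<in> block S a j"
    using assms(2) by (simp add: block_def)
  then have "block S a j \<noteq> {}" by blast
  then show ?thesis
    using assms(1) by (simp add: Suc_le_eq card_gt_0_iff)
qed

text \<open>Every other line shares a block with \<open>j\<close> in exactly one direction, while
  \<open>j\<close> itself is counted once per direction.\<close>

lemma sum_card_block_over_directions:
  fixes S :: "('a::idom \<times> 'a) set"
  assumes "finite S" "finite I" "meets_over I S" "j \<in> S"
  shows "(\<Sum>a\<in>I. card (block S a j)) + 1 = card S + card I"
proof -
  have "S - {j} = (\<Union>a\<in>I. block S a j - {j})"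
  proof
    show "S - {j} \<subseteq> (\<Union>a\<in>I. block S a j - {j})"
    proof
      fix k assume k: "k \<in> S - {j}"
      then obtain a where "a \<in> I" "ht a k = ht a j"
        using assms(3,4) unfolding meets_over_def by blast
      then show "k \<in> (\<Union>a\<in>I. block S a j - {j})"
        using k by (auto simp: block_def)
    qed
  qed (auto simp: block_def)
  moreover have "(block S a j - {j}) \<inter> (block S b j - {j}) = {}" if "a \<noteq> b" for a b
  proof -
    have False if "k \<in> block S a j - {j}" "k \<in> block S b j - {j}" for k
      using that \<open>a \<noteq> b\<close> ht_eq_unique[of k j a b] by (auto simp: block_def)
    then show ?thesis by blast
  qed
  then have "card (\<Union>a\<in>I. block S a j - {j}) = (\<Sum>a\<in>I. card (block S a j - {j}))"
    using assms(1,2) by (intro card_UN_disjoint) auto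
  ultimately have "card (S - {j}) = (\<Sum>a\<in>I. card (block S a j - {j}))"
    by simp
  moreover have "card (block S a j) = card (block S a j - {j}) + 1" for a
    using card.remove[of "block S a j" j] assms(1,4) by (simp add: block_def)
  moreover have "card S = card (S - {j}) + 1"
    using card.remove[OF assms(1,4)] by simp
  ultimately show ?thesis
    by (simp add: sum_Suc)
qed

lemma card_singles:
  assumes "finite S"
  shows "card (singles S a) = card {c \<in> ht a ` S. card {k \<in> S. ht a k = c} = 1}"
proof -
  have "inj_on (ht a) (singles S a)"
  proof (rule inj_onI)
    fix j k assume jk: "j \<in> singles S a" "k \<in> singles S a" "ht a j = ht a k"
    then have "j \<in> block S a j" "k \<in> block S a j" "card (block S a j) = 1"
      by (auto simp: singles_def block_def)
    then show "j = k"
      by (metis card_1_singletonE singletonD)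
  qed
  moreover have "ht a ` singles S a = {c \<in> ht a ` S. card {k \<in> S. ht a k = c} = 1}"
    by (auto simp: singles_def block_def)
  ultimately show ?thesis
    by (metis card_image)
qed

text \<open>Double counting of the pairs \<open>(a, j)\<close> in which \<open>j\<close> is alone
  over \<open>a\<close>.\<close>

lemma sum_card_singles:
  assumes "finite S" "finite I"
  shows "(\<Sum>a\<in>I. card (singles S a)) = (\<Sum>j\<in>S. card {a \<in> I. card (block S a j) = 1})"
proof -
  have "(\<Sum>a\<in>I. card (singles S a)) = (\<Sum>a\<in>I. \<Sum>j\<in>S. of_bool (card (block S a j) = 1))"
    using assms by (simp add: singles_def Int_def)
  also have "\<dots> = (\<Sum>j\<in>S. \<Sum>a\<in>I. of_bool (card (block S a j) = 1))"
    by (rule sum.swap)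
  also have "\<dots> = (\<Sum>j\<in>S. card {a \<in> I. card (block S a j) = 1})"
    using assms by (simp add: Int_def)
  finally show ?thesis .
qed

lemma card_le_sum_card_singles:
  assumes "finite S" "finite I" "X \<subseteq> S" "\<And>j. j \<in> X \<Longrightarrow> \<exists>a\<in>I. card (block S a j) = 1"
  shows "card X \<le> (\<Sum>a\<in>I. card (singles S a))"
proof -
  have "card X = (\<Sum>j\<in>X. 1)" by simp
  also have "\<dots> \<le> (\<Sum>j\<in>X. card {a \<in> I. card (block S a j) = 1})"
  proof (rule sum_mono)
    fix j assume "j \<in> X"
    then show "1 \<le> card {a \<in> I. card (block S a j) = 1}"
      using assms(2) assms(4)[of j] by (auto simp: Suc_le_eq card_gt_0_iff)
  qed
  also have "\<dots> \<le> (\<Sum>j\<in>S. card {a \<in> I. card (block S a j) = 1})"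
    using assms(1,3) by (intro sum_mono2) auto
  also have "\<dots> = (\<Sum>a\<in>I. card (singles S a))"
    by (rule sum_card_singles[symmetric, OF assms(1,2)])
  finally show ?thesis .
qed

section \<open>Lower bounds for the number of singleton blocks\<close>

lemma few_lines_many_singles:
  fixes S :: "('a::idom \<times> 'a) set"
  assumes "finite S" "finite I" "meets_over I S" "S \<noteq> {}" "card S \<le> card I"
  shows "card S + card I \<le> 2 * (\<Sum>a\<in>I. card (singles S a))"
proof -
  let ?s = "card S" and ?m = "card I"
  have s1: "?s \<ge> 1"
    using assms(1,4) by (simp add: Suc_le_eq card_gt_0_iff)
  \<comment> \<open>Every direction contributes at least 2 to block size plus singleton indicator,
    whereas the block sizes of \<open>j\<close> sum to only \<open>?s + ?m - 1\<close>.\<close>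
  have "?m + 1 - ?s \<le> card {a \<in> I. card (block S a j) = 1}" if "j \<in> S" for j
  proof -
    let ?U = "{a \<in> I. card (block S a j) = 1}"
    have "(\<Sum>a\<in>I. 2) \<le> (\<Sum>a\<in>I. card (block S a j) + of_bool (card (block S a j) = 1))"
    proof (rule sum_mono)
      fix a assume "a \<in> I"
      show "2 \<le> card (block S a j) + of_bool (card (block S a j) = 1)"
        using card_block_pos[OF assms(1) that, of a] by auto
    qed
    also have "\<dots> = (\<Sum>a\<in>I. card (block S a j)) + card ?U"
      using assms(2) by (simp add: sum.distrib Int_def)
    finally have "2 * ?m \<le> (\<Sum>a\<in>I. card (block S a j)) + card ?U"
      by simp
    then show ?thesis
      using sum_card_block_over_directions[OF assms(1-3) that] by linarith
  qed
  then have "(\<Sum>j\<in>S. ?m + 1 - ?s) \<le> (\<Sum>j\<in>S. card {a \<in> I. card (block S a j) = 1})"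
    by (rule sum_mono)
  then have *: "?s * (?m + 1 - ?s) \<le> (\<Sum>a\<in>I. card (singles S a))"
    using sum_card_singles[OF assms(1,2)] by simp
  obtain d where d: "?m = ?s + d"
    using assms(5) le_Suc_ex by blast
  have "?s + d \<le> ?s * (d + 1)"
    using mult_le_mono1[OF s1, of d] by simp
  moreover have "?m + 1 - ?s = d + 1"
    using d by simp
  ultimately show ?thesis
    using * d s1 by (simp only: mult_2)
qed

text \<open>Each of the remaining blocks uses up at least one line.\<close>

lemma two_fibres_le:
  assumes "finite S" "c \<in> ht a ` S" "c' \<in> ht a ` S" "c \<noteq> c'"
  shows "card {k \<in> S. ht a k = c} + card {k \<in> S. ht a k = c'} + card (ht a ` S) \<le> card S + 2"
proof -
  let ?b = "\<lambda>c. card {k \<in> S. ht a k = c}" and ?C = "ht a ` S"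
  have "card (?C - {c, c'}) \<le> (\<Sum>x\<in>?C - {c, c'}. ?b x)"
  proof -
    have "(\<Sum>x\<in>?C - {c, c'}. 1) \<le> (\<Sum>x\<in>?C - {c, c'}. ?b x)"
      using assms(1) by (intro sum_mono) (auto simp: Suc_le_eq card_gt_0_iff)
    then show ?thesis by simp
  qed
  moreover have "card S = (\<Sum>x\<in>?C - {c, c'}. ?b x) + (?b c + ?b c')"
    using sum_card_fibres[OF assms(1), of "ht a"] sum.subset_diff[of "{c, c'}" ?C ?b] assms
    by simp
  moreover have "card (?C - {c, c'}) = card ?C - 2"
    using assms by (subst card_Diff_subset) auto
  ultimately show ?thesis by linarith
qed

lemma fibre_le:
  assumes "finite S" "c \<in> ht a ` S"
  shows "card {k \<in> S. ht a k = c} + card (ht a ` S) \<le> card S + 1"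
proof (cases "ht a ` S = {c}")
  case True
  then show ?thesis
    using assms(1) by (simp add: card_mono)
next
  case False
  then obtain c' where c': "c' \<in> ht a ` S" "c' \<noteq> c"
    using assms(2) by blast
  have "card {k \<in> S. ht a k = c'} \<ge> 1"
    using assms(1) c' by (auto simp: Suc_le_eq card_gt_0_iff)
  then show ?thesis
    using two_fibres_le[OF assms(1,2) c'(1) c'(2)[symmetric]] by linarith
qed

text \<open>
  For block sizes \<open>b\<close> up to 4, \<open>(b - 2) (b - 3)\<close> is \<open>2\<close> if \<open>b \<in> {1, 4}\<close> and \<open>0\<close> otherwise; its sum over all
  blocks is known because each pair of lines lies in exactly one block.
\<close>

lemma singles_count:
  fixes S :: "('a::idom \<times> 'a) set"
  assumes "finite S" "finite I" "meets_over I S"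
    and small: "\<And>a c. a \<in> I \<Longrightarrow> c \<in> ht a ` S \<Longrightarrow> card {k \<in> S. ht a k = c} \<le> 4"
  shows "card S * (card S + card I - 1) + 6 * (\<Sum>a\<in>I. card (ht a ` S)) =
    5 * card S * card I + 2 * (\<Sum>a\<in>I. card (singles S a))
      + 2 * (\<Sum>a\<in>I. card {c \<in> ht a ` S. card {k \<in> S. ht a k = c} = 4})"
proof -
  let ?b = "\<lambda>a c. card {k \<in> S. ht a k = c}"
  have dir: "(\<Sum>j\<in>S. card (block S a j)) + 6 * card (ht a ` S) =
      5 * card S + 2 * card (singles S a) + 2 * card {c \<in> ht a ` S. ?b a c = 4}" if "a \<in> I" for a
  proof -
    have "(\<Sum>j\<in>S. card (block S a j)) = (\<Sum>c\<in>ht a ` S. \<Sum>j\<in>{k \<in> S. ht a k = c}. card (block S a j))"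
      using assms(1) by (rule sum.image_gen)
    also have "\<dots> = (\<Sum>c\<in>ht a ` S. ?b a c * ?b a c)"
      by (intro sum.cong) (auto simp: block_def)
    finally have sq: "(\<Sum>j\<in>S. card (block S a j)) = (\<Sum>c\<in>ht a ` S. ?b a c * ?b a c)" .
    have "(\<Sum>c\<in>ht a ` S. ?b a c * ?b a c + 6) =
        (\<Sum>c\<in>ht a ` S. 5 * ?b a c + 2 * of_bool (?b a c = 1) + 2 * of_bool (?b a c = 4))"
    proof (rule sum.cong)
      fix c assume c: "c \<in> ht a ` S"
      then have "?b a c \<ge> 1"
        using assms(1) by (auto simp: Suc_le_eq card_gt_0_iff)
      then have "?b a c \<in> {1, 2, 3, 4}"
        using small[OF that c] by auto
      then show "?b a c * ?b a c + 6 = 5 * ?b a c + 2 * of_bool (?b a c = 1) + 2 * of_bool (?b a c = 4)"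
        by auto
    qed simp
    also have "\<dots> = 5 * (\<Sum>c\<in>ht a ` S. ?b a c) + 2 * card {c \<in> ht a ` S. ?b a c = 1}
        + 2 * card {c \<in> ht a ` S. ?b a c = 4}"
      using assms(1) by (simp add: sum.distrib sum_distrib_left[symmetric] Int_def)
    finally show ?thesis
      by (simp add: sq sum_card_fibres[OF assms(1)] card_singles[OF assms(1)] sum.distrib)
  qed
  have "(\<Sum>a\<in>I. \<Sum>j\<in>S. card (block S a j)) = (\<Sum>j\<in>S. \<Sum>a\<in>I. card (block S a j))"
    by (rule sum.swap)
  also have "\<dots> = (\<Sum>j\<in>S. card S + card I - 1)"
    using sum_card_block_over_directions[OF assms(1-3)] by (intro sum.cong refl) (metis add_diff_cancel_right')
  finally have "(\<Sum>a\<in>I. \<Sum>j\<in>S. card (block S a j)) = card S * (card S + card I - 1)"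
    by simp
  moreover have "(\<Sum>a\<in>I. (\<Sum>j\<in>S. card (block S a j)) + 6 * card (ht a ` S)) =
      (\<Sum>a\<in>I. 5 * card S + 2 * card (singles S a) + 2 * card {c \<in> ht a ` S. ?b a c = 4})"
    using dir by (intro sum.cong) auto
  ultimately show ?thesis
    by (simp add: sum.distrib sum_distrib_left[symmetric] mult.commute mult.left_commute)
qed

text \<open>The block sizes of a line sum to 10, so a line in a block of size at least 3 is alone in
  another direction. A block of size 4 makes all six lines alone somewhere. Without one, a block of
  size 3 exists since not all blocks are pairs; this gives four singletons, and divisibility by 3
  raises them to six.\<close>

lemma six_lines_five_directions:
  fixes S :: "('a::field_char_0 \<times> 'a) set"
  assumes "finite I" "meets_over I S" "card S = 6" "card I = 5"
    and blocks: "\<And>a. a \<in> I \<Longrightarrow> card (ht a ` S) \<ge> 3"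
  shows "(\<Sum>a\<in>I. card (singles S a)) \<ge> 6"
proof -
  have fin: "finite S"
    using assms(3) by (metis card.infinite zero_neq_numeral)
  have total: "(\<Sum>a\<in>I. card (block S a j)) = 10" if "j \<in> S" for j
    using sum_card_block_over_directions[OF fin assms(1,2) that] assms(3,4) by simp
  have big: "\<exists>b\<in>I. card (block S b j) = 1" if "j \<in> S" "a \<in> I" "card (block S a j) \<ge> 3" for a j
  proof (rule ccontr)
    assume no: "\<not> (\<exists>b\<in>I. card (block S b j) = 1)"
    have "(\<Sum>b\<in>I. 2) < (\<Sum>b\<in>I. card (block S b j))"
    proof (rule sum_strict_mono_ex1)
      show "\<forall>b\<in>I. 2 \<le> card (block S b j)"
      proof
        fix b assume "b \<in> I"
        then show "2 \<le> card (block S b j)"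
          using no card_block_pos[OF fin that(1), of b] by (metis One_nat_def Suc_1 le_antisym not_less_eq_eq)
      qed
      show "\<exists>b\<in>I. 2 < card (block S b j)"
        using that by (intro bexI[of _ a]) auto
    qed (rule assms(1))
    then show False
      using total[OF that(1)] assms(4) by simp
  qed
  have small: "card {k \<in> S. ht a k = c} \<le> 4" if "a \<in> I" "c \<in> ht a ` S" for a c
    using fibre_le[OF fin that(2)] blocks[OF that(1)] assms(3) by linarith
  show ?thesis
  proof (cases "\<exists>a\<in>I. \<exists>j\<in>S. card (block S a j) = 4")
    case True
    then obtain a j where aj: "a \<in> I" "j \<in> S" "card (block S a j) = 4" by blast
    have "\<exists>b\<in>I. card (block S b k) = 1" if "k \<in> S" for k
    proof (cases "ht a k = ht a j")
      case True
      then show ?thesis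
        using aj that by (intro big[of k a]) (auto simp: block_def)
    next
      case False
      \<comment> \<open>At least three blocks, one of them of size 4, leave only singletons besides
        it.\<close>
      have "card (block S a k) \<le> 1"
        using two_fibres_le[OF fin, of "ht a k" a "ht a j"] False that aj blocks[OF aj(1)] assms(3)
        by (auto simp: block_def)
      then show ?thesis
        using card_block_pos[OF fin that, of a] aj(1) by (intro bexI[of _ a]) auto
    qed
    then show ?thesis
      using card_le_sum_card_singles[OF fin assms(1) order.refl] assms(3) by metis
  next
    case no4: False
    have "\<not> (\<forall>a\<in>I. \<forall>j\<in>S. card (block S a j) = 2)"
      using no_six_lines_in_pairs[OF assms(3,1)] assms(4) by (auto simp: block_def)
    then obtain a0 j0 where j0: "a0 \<in> I" "j0 \<in> S" "card (block S a0 j0) \<noteq> 2" by blast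
    have "\<exists>a\<in>I. card (block S a j0) \<ge> 3"
    proof (rule ccontr)
      assume no: "\<not> (\<exists>a\<in>I. card (block S a j0) \<ge> 3)"
      have "(\<Sum>b\<in>I. card (block S b j0)) < (\<Sum>b\<in>I. 2)"
      proof (rule sum_strict_mono_ex1[OF assms(1)])
        show "\<forall>b\<in>I. card (block S b j0) \<le> 2"
          using no by (auto simp: not_le)
        then show "\<exists>b\<in>I. card (block S b j0) < 2"
          using j0 by (intro bexI[of _ a0]) (auto simp: le_less)
      qed
      then show False
        using total[OF j0(2)] assms(4) by simp
    qed
    then obtain a where a: "a \<in> I" "card (block S a j0) \<ge> 3" by blast
    \<comment> \<open>Three or more blocks of size at least 2, one of them larger, would need more
      than six lines.\<close>
    have "singles S a \<noteq> {}"
    proof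
      assume "singles S a = {}"
      then have none: "card {c \<in> ht a ` S. card {k \<in> S. ht a k = c} = 1} = 0"
        using card_singles[OF fin, of a] by simp
      have "(\<Sum>c\<in>ht a ` S. 2) < (\<Sum>c\<in>ht a ` S. card {k \<in> S. ht a k = c})"
      proof (rule sum_strict_mono_ex1)
        show "\<forall>c\<in>ht a ` S. 2 \<le> card {k \<in> S. ht a k = c}"
        proof
          fix c assume c: "c \<in> ht a ` S"
          then have "card {k \<in> S. ht a k = c} \<noteq> 0"
            using fin by auto
          moreover have "card {k \<in> S. ht a k = c} \<noteq> 1"
            using none fin c by (auto simp: card_eq_0_iff)
          ultimately show "2 \<le> card {k \<in> S. ht a k = c}"
            by linarith
        qed
        show "\<exists>c\<in>ht a ` S. 2 < card {k \<in> S. ht a k = c}"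
          using a(2) j0(2) by (intro bexI[of _ "ht a j0"]) (auto simp: block_def)
      qed (use fin in simp)
      then show False
        using sum_card_fibres[OF fin, of "ht a"] blocks[OF a(1)] assms(3) by simp
    qed
    then obtain k where k: "k \<in> S" "card (block S a k) = 1"
      by (auto simp: singles_def)
    have "card (insert k (block S a j0)) \<le> (\<Sum>a\<in>I. card (singles S a))"
    proof (rule card_le_sum_card_singles[OF fin assms(1)])
      show "insert k (block S a j0) \<subseteq> S"
        using k by (auto simp: block_def)
      fix i assume "i \<in> insert k (block S a j0)"
      then show "\<exists>b\<in>I. card (block S b i) = 1"
      proof
        assume "i \<in> block S a j0"
        then show ?thesis
          using a by (intro big[of i a]) (auto simp: block_def)
      qed (use k a in auto)
    qed
    moreover have "k \<notin> block S a j0"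
    proof
      assume "k \<in> block S a j0"
      then have "block S a k = block S a j0"
        by (auto simp: block_def)
      then show False
        using k a by simp
    qed
    ultimately have "(\<Sum>a\<in>I. card (singles S a)) \<ge> 4"
      using a(2) fin by simp
    moreover have "{c \<in> ht a ` S. card {k \<in> S. ht a k = c} = 4} = {}" if "a \<in> I" for a
      using no4 that by (auto simp: block_def)
    then have "(\<Sum>a\<in>I. card {c \<in> ht a ` S. card {k \<in> S. ht a k = c} = 4}) = 0"
      by (intro sum.neutral ballI) (simp only: card.empty)
    then have "60 + 6 * (\<Sum>a\<in>I. card (ht a ` S)) = 150 + 2 * (\<Sum>a\<in>I. card (singles S a))"
      using singles_count[OF fin assms(1,2) small] assms(3,4) by simp
    ultimately show ?thesis
      \<comment> \<open>The counting identity gives \<open>t = 3 n - 45\<close> for the number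
        \<open>t\<close> of singletons and the number \<open>n\<close> of blocks; so
        \<open>t\<close> is a multiple of 3, and \<open>t >= 4\<close> becomes
        \<open>t >= 6\<close>.\<close>
      by presburger
  qed
qed

text \<open>\<open>split\<close> is what homogeneity will supply. If some direction separates all
  lines, every line is alone there, and \<open>card S > card I\<close> finishes. Otherwise
  \<open>direction_bounds\<close> gives \<open>card S <= 2 * card I - 3\<close>, leaving three
  cases.\<close>

lemma many_singles:
  fixes S :: "('a::field_char_0 \<times> 'a) set"
  assumes "finite S" "finite I" "meets_over I S" "S \<noteq> {}" "3 \<le> card I" "card I \<le> 5"
    and split: "\<And>a. card S > card I \<Longrightarrow> a \<in> I \<Longrightarrow> card (ht a ` S) \<ge> 2"
  shows "card S + card I \<le> 2 * (\<Sum>a\<in>I. card (singles S a))"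
proof (cases "card S \<le> card I")
  case True
  then show ?thesis
    using few_lines_many_singles assms by blast
next
  case False
  let ?s = "card S" and ?m = "card I" and ?n = "\<lambda>a. card (ht a ` S)"
  let ?t = "\<Sum>a\<in>I. card (singles S a)" and ?w = "\<lambda>a. card {c \<in> ht a ` S. card {k \<in> S. ht a k = c} = 4}"
  show ?thesis
  proof (cases "\<exists>a\<in>I. ?n a = ?s")
    case True
    then obtain a where a: "a \<in> I" "?n a = ?s" by blast
    have "card (block S a j) = 1" if "j \<in> S" for j
    proof -
      have "inj_on (ht a) S"
        using a(2) assms(1) by (simp add: eq_card_imp_inj_on)
      then have "block S a j = {j}"
        using that by (auto simp: block_def inj_on_def)
      then show ?thesis by simp
    qed
    then have "?s \<le> ?t"
      using card_le_sum_card_singles[OF assms(1,2) order.refl] a(1) by blast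
    then show ?thesis
      using False by simp
  next
    case undet: False
    have n: "?n a < ?m" "?s + 2 \<le> ?n a + ?m" if "a \<in> I" for a
    proof -
      have "?n a < ?s"
        using undet that card_image_le[OF assms(1), of "ht a"] by (metis le_neq_implies_less)
      then show "?n a < ?m" "?s + 2 \<le> ?n a + ?m"
        using direction_bounds[OF assms(1-3) that] split[of a] False that by auto
    qed
    have fib: "card {k \<in> S. ht a k = c} \<le> ?m - 1" if "a \<in> I" "c \<in> ht a ` S" for a c
      using fibre_le[OF assms(1) that(2)] n[OF that(1)] by linarith
    then have small: "card {k \<in> S. ht a k = c} \<le> 4" if "a \<in> I" "c \<in> ht a ` S" for a c
      using that assms(6) by fastforce
    note count = singles_count[OF assms(1-3) small]
    have const: "(\<Sum>a\<in>I. ?n a) = ?m * x" if "\<And>a. a \<in> I \<Longrightarrow> ?n a = x" for x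
      using that by simp
    obtain a0 where a0: "a0 \<in> I"
      using assms(5) by (metis card.empty all_not_in_conv not_numeral_le_zero)
    consider "?m = 4" "?s = 5" | "?m = 5" "?s = 6" | "?m = 5" "?s = 7"
      using n[OF a0] assms(5,6) False by linarith
    then show ?thesis
    proof cases
      case 1
      \<comment> \<open>Both bounds pin the block number to 3 and blocks have size at most 3, so the
        identity yields exactly 6 singletons.\<close>
      have "?n a = 3" if "a \<in> I" for a
        using n[OF that] 1 by linarith
      then have "(\<Sum>a\<in>I. ?n a) = 12"
        using const[of 3] 1 by simp
      moreover have "{c \<in> ht a ` S. card {k \<in> S. ht a k = c} = 4} = {}" if "a \<in> I" for a
        using fib[OF that] 1 by fastforce
      then have "(\<Sum>a\<in>I. ?w a) = 0"
        by (intro sum.neutral ballI) (simp only: card.empty)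
      ultimately show ?thesis
        using count 1 by simp
    next
      case 2
      have "?n a \<ge> 3" if "a \<in> I" for a
        using n[OF that] 2 by linarith
      then have "?t \<ge> 6"
        using six_lines_five_directions[OF assms(2,3)] 2 by blast
      then show ?thesis using 2 by simp
    next
      case 3
      \<comment> \<open>With 20 blocks in total, singletons and blocks of size 4 together number 11.
        Seven lines in four blocks allow at most one block of size 4 per direction, which leaves at
        least 6 singletons.\<close>
      have n4: "?n a = 4" if "a \<in> I" for a
        using n[OF that] 3 by linarith
      then have "(\<Sum>a\<in>I. ?n a) = 20"
        using const[of 4] 3 by simp
      moreover have "?w a \<le> 1" if "a \<in> I" for a
      proof -
        have "(\<Sum>c\<in>ht a ` S. 1 + 3 * of_bool (card {k \<in> S. ht a k = c} = 4)) \<le>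
            (\<Sum>c\<in>ht a ` S. card {k \<in> S. ht a k = c})"
          using assms(1) by (intro sum_mono) (auto simp: Suc_le_eq card_gt_0_iff)
        also have "\<dots> = 7"
          using sum_card_fibres[OF assms(1)] 3 by simp
        finally have "(\<Sum>c\<in>ht a ` S. 1) + 3 * (\<Sum>c\<in>ht a ` S. of_bool (card {k \<in> S. ht a k = c} = 4)) \<le> (7::nat)"
          by (simp only: sum.distrib sum_distrib_left)
        then have "?n a + 3 * ?w a \<le> 7"
          using assms(1) by (simp add: Int_def)
        then show ?thesis
          using n4[OF that] by simp
      qed
      then have "(\<Sum>a\<in>I. ?w a) \<le> (\<Sum>a\<in>I. 1)"
        by (rule sum_mono)
      ultimately show ?thesis
        using count 3 by simp
    qed
  qed
qed

subsection \<open>Coordinates on the projective plane\<close>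

lemma proj_point_span:
  assumes "w \<noteq> 0"
  shows "proj_point (vec.span {w})"
  using assms by (simp add: proj_point_def vec.dim_span del: vec.span_insert)

lemma proj_point_obtain:
  assumes "proj_point p"
  obtains e where "e \<noteq> 0" "p = {t *s e | t. True}"
proof -
  obtain B where B: "B \<subseteq> p" "vec.independent B" "p \<subseteq> vec.span B" "card B = vec.dim p"
    using vec.basis_exists by blast
  then obtain e where e: "B = {e}"
    using assms unfolding proj_point_def by (metis card_1_singletonE)
  have "p = vec.span {e}"
    using B e assms unfolding proj_point_def by (metis subset_antisym vec.span_minimal)
  moreover have "vec.span {e} = {t *s e | t. True}"
    by (auto simp: vec.span_singleton)
  moreover have "e \<noteq> 0"
    using B(2) e by auto
  ultimately show ?thesis using that by blast
qed

lemma proj_point_eq_inter: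
  assumes "proj_line L" "proj_line M" "L \<noteq> M" "proj_point q" "q \<subseteq> L" "q \<subseteq> M"
  shows "q = L \<inter> M"
proof (rule vec.subspace_dim_equal)
  show sub: "vec.subspace (L \<inter> M)"
    using assms(1,2) by (simp add: proj_line_def vec.subspace_inter)
  show "vec.subspace q" "q \<subseteq> L \<inter> M"
    using assms by (auto simp: proj_point_def)
  have "\<not> vec.dim (L \<inter> M) \<ge> 2"
  proof
    assume "vec.dim (L \<inter> M) \<ge> 2"
    then have "L \<inter> M = L" "L \<inter> M = M"
      using assms(1,2) sub vec.subspace_dim_equal[of "L \<inter> M"] by (simp_all add: proj_line_def)
    then show False using assms(3) by simp
  qed
  then show "vec.dim (L \<inter> M) \<le> vec.dim q"
    using assms(4) by (simp add: proj_point_def)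
qed

lemma proj_join_eq:
  assumes "proj_point q" "proj_point r" "q \<noteq> r" "proj_line M" "q \<subseteq> M" "r \<subseteq> M"
  shows "proj_join q r = M"
  unfolding proj_join_def
proof (rule vec.subspace_dim_equal)
  show "vec.span (q \<union> r) \<subseteq> M"
    using assms by (intro vec.span_minimal) (auto simp: proj_line_def)
  have "\<not> vec.dim (vec.span (q \<union> r)) \<le> 1"
  proof
    assume d: "vec.dim (vec.span (q \<union> r)) \<le> 1"
    have "q = vec.span (q \<union> r)" "r = vec.span (q \<union> r)"
      using assms(1,2) d vec.span_superset[of "q \<union> r"] vec.subspace_span[of "q \<union> r"]
        vec.subspace_dim_equal[of q "vec.span (q \<union> r)"] vec.subspace_dim_equal[of r "vec.span (q \<union> r)"]
      by (simp_all add: proj_point_def del: vec.dim_span)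
    then show False using assms(3) by simp
  qed
  then show "vec.dim M \<le> vec.dim (vec.span (q \<union> r))"
    using assms(4) by (simp add: proj_line_def)
qed (use assms(4) in \<open>auto simp: proj_line_def\<close>)

text \<open>For \<open>b\<close> outside \<open>L\<close>, the projection \<open>g\<close> onto the
  span of \<open>b\<close> has kernel \<open>L\<close>. The matrix row of \<open>g\<close> at a
  coordinate where \<open>b\<close> is nonzero is the required normal vector.\<close>

lemma proj_line_equation:
  assumes "proj_line L"
  obtains n :: "complex ^ 3" where "n \<noteq> 0" "L = {w. (\<Sum>l\<in>UNIV. n $ l * w $ l) = 0}"
proof -
  have sub: "vec.subspace L" and d2: "vec.dim L = 2"
    using assms by (auto simp: proj_line_def)
  obtain B where B: "B \<subseteq> L" "vec.independent B" "L \<subseteq> vec.span B" "card B = 2"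
    using vec.basis_exists[of L] d2 by metis
  have finB: "finite B"
    using B(4) by (metis card.infinite zero_neq_numeral)
  have LB: "L = vec.span B"
    using B sub by (metis subset_antisym vec.span_minimal)
  have d3: "vec.dim (UNIV :: (complex ^ 3) set) = 3"
    by (simp only: vec_dim_card) simp
  then obtain b where b: "b \<notin> L"
    using d2 by (metis UNIV_eq_I numeral_eq_iff semiring_norm(88))
  have bB: "b \<notin> B"
    using b B(1) by blast
  have ind: "vec.independent (insert b B)"
    using B(2) b LB bB by (simp add: vec.independent_insert)
  have spanU: "vec.span (insert b B) = UNIV"
  proof (rule vec.subspace_dim_equal)
    show "vec.dim (UNIV :: (complex ^ 3) set) \<le> vec.dim (vec.span (insert b B))"
      unfolding vec.dim_span_eq_card_independent[OF ind] d3 using B(4) finB bB by simp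
  qed simp_all
  obtain g where g: "Vector_Spaces.linear (*s) (*s) g" "\<And>x. x \<in> insert b B \<Longrightarrow> g x = (if x = b then b else 0)"
    using vec.linear_independent_extend[OF ind, of "\<lambda>x. if x = b then b else 0"] by blast
  have gL: "g w = 0" if "w \<in> L" for w
  proof (rule vec.linear_eq_0_on_span[OF g(1)])
    show "g x = 0" if "x \<in> B" for x
    proof -
      have "x \<noteq> b" using that bB by blast
      then show ?thesis using g(2)[of x] that by simp
    qed
    show "w \<in> vec.span B"
      using that LB by simp
  qed
  have gk: "\<exists>k. w - k *s b \<in> L \<and> g w = k *s b" for w
  proof -
    obtain k where k: "w - k *s b \<in> L"
      using spanU LB vec.span_breakdown_eq[of w b B] by auto
    have "g (w - k *s b) = g w - k *s g b"
      using g(1) by (simp add: vec.linear_diff vec.linear_scale)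
    then show ?thesis
      using gL[OF k] g(2)[of b] k by auto
  qed
  have "b \<noteq> 0"
    using b sub by (metis vec.subspace_0)
  then obtain l where l: "b $ l \<noteq> 0"
    by (metis vec_eq_iff zero_index)
  define n where "n = matrix g $ l"
  have n: "(\<Sum>i\<in>UNIV. n $ i * w $ i) = g w $ l" for w
    using matrix_works[OF g(1), of w] by (simp add: n_def matrix_vector_mult_def vec_eq_iff)
  have "L = {w. (\<Sum>i\<in>UNIV. n $ i * w $ i) = 0}"
  proof (intro set_eqI iffI)
    fix w assume "w \<in> {w. (\<Sum>i\<in>UNIV. n $ i * w $ i) = 0}"
    then have "g w $ l = 0" by (simp add: n)
    then show "w \<in> L"
      using gk[of w] l by auto
  qed (use gL n in auto)
  moreover have "n \<noteq> 0"
  proof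
    assume "n = 0"
    then show False
      using n[of b] g(2)[of b] l by simp
  qed
  ultimately show ?thesis using that by blast
qed

text \<open>Homogeneous linear coordinates, with \<open>X0 = 0\<close> as the line at infinity and
  \<open>(X1 / X0, Y / X0)\<close> as affine coordinates.\<close>

locale plane_coords =
  fixes X0 X1 Y :: "complex ^ 3 \<Rightarrow> complex"
  assumes scale: "X0 (t *s w) = t * X0 w" "X1 (t *s w) = t * X1 w" "Y (t *s w) = t * Y w"
    and coord_inject: "X0 w = X0 w' \<Longrightarrow> X1 w = X1 w' \<Longrightarrow> Y w = Y w' \<Longrightarrow> w = w'"
    and coord_surject: "\<exists>w. X0 w = a \<and> X1 w = b \<and> Y w = c"
    and line_equation: "proj_line L \<Longrightarrow>
      \<exists>\<alpha> \<beta> \<gamma>. (\<alpha> \<noteq> 0 \<or> \<beta> \<noteq> 0 \<or> \<gamma> \<noteq> 0) \<and> L = {w. \<alpha> * X0 w + \<beta> * X1 w + \<gamma> * Y w = 0}"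
begin

section \<open>The affine chart: vertical lines through the center, other lines as graphs\<close>

definition center :: "(complex ^ 3) set" where
  "center = {w. X0 w = 0 \<and> X1 w = 0}"

definition vline :: "complex \<Rightarrow> (complex ^ 3) set" where
  "vline a = {w. X1 w = a * X0 w}"

definition hline :: "complex \<times> complex \<Rightarrow> (complex ^ 3) set" where
  "hline j = {w. Y w = fst j * X1 w + snd j * X0 w}"

definition pt :: "complex \<Rightarrow> complex \<Rightarrow> (complex ^ 3) set" where
  "pt a c = {w. X1 w = a * X0 w \<and> Y w = c * X0 w}"

lemma proj_point_pt: "proj_point (pt a c)"
proof -
  obtain w where w: "X0 w = 1" "X1 w = a" "Y w = c"
    using coord_surject by blast
  have "pt a c = vec.span {w}"
  proof (intro set_eqI iffI)
    fix v assume "v \<in> pt a c"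
    then have "v = X0 v *s w"
      by (intro coord_inject) (auto simp: pt_def scale w)
    then show "v \<in> vec.span {w}"
      by (auto simp: vec.span_singleton)
  qed (auto simp: vec.span_singleton pt_def scale w)
  moreover have "w \<noteq> 0"
    using w(1) scale(1)[of 0 0] by auto
  ultimately show ?thesis
    using proj_point_span by simp
qed

lemma center_subset_vline: "center \<subseteq> vline a"
  by (auto simp: center_def vline_def)

lemma not_center_subset_hline: "\<not> center \<subseteq> hline j"
proof -
  obtain w where "X0 w = 0" "X1 w = 0" "Y w = 1"
    using coord_surject by blast
  then have "w \<in> center" "w \<notin> hline j"
    by (auto simp: center_def hline_def)
  then show ?thesis by blast
qed

lemma pt_subset_vline: "pt a c \<subseteq> vline b \<longleftrightarrow> a = b"
proof
  assume *: "pt a c \<subseteq> vline b"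
  obtain w where "X0 w = 1" "X1 w = a" "Y w = c"
    using coord_surject by blast
  moreover from this have "w \<in> vline b"
    using * by (auto simp: pt_def)
  ultimately show "a = b"
    by (simp add: vline_def)
qed (auto simp: pt_def vline_def)

lemma pt_subset_hline: "pt a c \<subseteq> hline j \<longleftrightarrow> ht a j = c"
proof
  assume *: "pt a c \<subseteq> hline j"
  obtain w where "X0 w = 1" "X1 w = a" "Y w = c"
    using coord_surject by blast
  moreover from this have "w \<in> hline j"
    using * by (auto simp: pt_def)
  ultimately show "ht a j = c"
    by (simp add: hline_def ht_def)
qed (auto simp: pt_def hline_def ht_def algebra_simps)

lemma pt_inject: "pt a c = pt b d \<longleftrightarrow> a = b \<and> c = d"
proof
  assume *: "pt a c = pt b d"
  obtain w where "X0 w = 1" "X1 w = a" "Y w = c"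
    using coord_surject by blast
  moreover from this have "w \<in> pt b d"
    unfolding *[symmetric] by (simp add: pt_def)
  ultimately show "a = b \<and> c = d"
    by (simp add: pt_def)
qed simp

lemma vline_inject: "vline a = vline b \<longleftrightarrow> a = b"
  using pt_subset_vline[of a 0] by auto

lemma hline_inject: "hline j = hline k \<longleftrightarrow> j = k"
proof
  assume "hline j = hline k"
  then have "ht a k = ht a j" for a
    using pt_subset_hline[of a "ht a j" j] pt_subset_hline[of a "ht a j" k] by simp
  from this[of 0] this[of 1] show "j = k"
    by (simp add: ht_def prod_eq_iff)
qed simp

lemma vline_neq_hline: "vline a \<noteq> hline j"
  using center_subset_vline not_center_subset_hline by metis

lemma pt_neq_center: "pt a c \<noteq> center"
proof
  assume *: "pt a c = center"
  obtain w where "X0 w = 1" "X1 w = a" "Y w = c"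
    using coord_surject by blast
  moreover from this have "w \<in> center"
    unfolding *[symmetric] by (simp add: pt_def)
  ultimately show False
    by (simp add: center_def)
qed

lemma line_cases:
  assumes "proj_line L" "L \<noteq> {w. X0 w = 0}"
  obtains a where "L = vline a" | j where "L = hline j"
proof -
  obtain \<alpha> \<beta> \<gamma> where *: "\<alpha> \<noteq> 0 \<or> \<beta> \<noteq> 0 \<or> \<gamma> \<noteq> 0" "L = {w. \<alpha> * X0 w + \<beta> * X1 w + \<gamma> * Y w = 0}"
    using line_equation[OF assms(1)] by blast
  consider "\<gamma> \<noteq> 0" | "\<gamma> = 0" "\<beta> \<noteq> 0" | "\<gamma> = 0" "\<beta> = 0"
    by blast
  then show ?thesis
  proof cases
    case 1
    have "\<alpha> * X0 w + \<beta> * X1 w + \<gamma> * Y w = 0 \<longleftrightarrow> Y w = (- \<beta> / \<gamma>) * X1 w + (- \<alpha> / \<gamma>) * X0 w" for w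
      using 1 by (simp add: field_simps eq_neg_iff_add_eq_0)
    then have "L = hline (- \<beta> / \<gamma>, - \<alpha> / \<gamma>)"
      using *(2) by (auto simp: hline_def)
    then show ?thesis using that by blast
  next
    case 2
    have "\<alpha> * X0 w + \<beta> * X1 w + \<gamma> * Y w = 0 \<longleftrightarrow> X1 w = (- \<alpha> / \<beta>) * X0 w" for w
      using 2 by (simp add: field_simps eq_neg_iff_add_eq_0 add.commute)
    then have "L = vline (- \<alpha> / \<beta>)"
      using *(2) by (auto simp: vline_def)
    then show ?thesis using that by blast
  next
    case 3
    then have "L = {w. X0 w = 0}"
      using * by auto
    then show ?thesis using assms(2) by blast
  qed
qed

text \<open>Lines of different slopes meet over a finite abscissa. Parallel ones meet at infinity,
  in a point other than the center and therefore on no vertical line.\<close>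

lemma hlines_meet:
  assumes "j \<noteq> k"
  obtains a where "ht a j = ht a k" | q where "proj_point q" "q \<subseteq> hline j" "q \<subseteq> hline k" "q \<noteq> center" "\<And>a. \<not> q \<subseteq> vline a"
proof (cases "fst j = fst k")
  case False
  define a where "a = (snd k - snd j) / (fst j - fst k)"
  have "(fst j - fst k) * a = snd k - snd j"
    using False by (simp add: a_def)
  then have "ht a j = ht a k"
    by (simp add: ht_def algebra_simps)
  then show ?thesis using that by blast
next
  case True
  obtain w where w: "X0 w = 0" "X1 w = 1" "Y w = fst j"
    using coord_surject by blast
  define q where "q = vec.span {w}"
  have q: "q = {t *s w | t. True}"
    by (auto simp: q_def vec.span_singleton)
  have "w \<noteq> 0"
    using w(2) scale(2)[of 0 0] by auto
  then have "proj_point q"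
    unfolding q_def by (rule proj_point_span)
  moreover have "q \<subseteq> hline j" "q \<subseteq> hline k"
    using True by (auto simp: q hline_def scale w)
  moreover have wq: "w \<in> q"
    by (simp add: q_def vec.span_base)
  then have "q \<noteq> center"
    using w(2) by (auto simp: center_def)
  moreover have "\<not> q \<subseteq> vline a" for a
    using wq w by (auto simp: vline_def)
  ultimately show ?thesis using that by blast
qed

end

text \<open>\<open>X\<close> and \<open>X'\<close> cut out \<open>p\<close>. The lines
  \<open>X + t X' = 0\<close> through \<open>p\<close> are pairwise distinct, so some
  \<open>t\<close> gives one outside the finite \<open>A\<close>; it is taken as the line at
  infinity.\<close>

lemma plane_coords_exist:
  assumes "proj_point p" "finite A"
  obtains X0 X1 Y where "plane_coords X0 X1 Y" "p = {w. X0 w = 0 \<and> X1 w = 0}" "{w. X0 w = 0} \<notin> A"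
proof -
  obtain e where e: "e \<noteq> 0" "p = {t *s e | t. True}"
    using proj_point_obtain[OF assms(1)] .
  obtain k where k: "e $ k \<noteq> 0"
    using e(1) by (metis vec_eq_iff zero_index)
  have "card (UNIV - {k} :: 3 set) = 2"
    by (simp add: card_Diff_singleton)
  then obtain i j where ij: "UNIV - {k} = {i, j}" "i \<noteq> j"
    unfolding card_2_iff by blast
  then have ne: "i \<noteq> k" "j \<noteq> k" "i \<noteq> j" and U: "UNIV = {i, j, k}"
    by auto
  have all: "(\<forall>l. P l) \<longleftrightarrow> P i \<and> P j \<and> P k" for P
    using U by (metis UNIV_I insertE singletonD)
  have sumU: "(\<Sum>l\<in>UNIV. f l) = f i + f j + f k" for f :: "3 \<Rightarrow> complex"
    unfolding U using ne by (simp add: add.assoc)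
  define X where "X w = e $ k * w $ i - e $ i * w $ k" for w
  define X' where "X' w = e $ k * w $ j - e $ j * w $ k" for w
  have surj: "\<exists>w. X w = a \<and> X' w = b \<and> w $ k = c" for a b c
  proof -
    define w :: "complex ^ 3" where
      "w = (\<chi> l. if l = k then c else if l = i then (a + e $ i * c) / e $ k else (b + e $ j * c) / e $ k)"
    have "w $ k = c" "w $ i = (a + e $ i * c) / e $ k" "w $ j = (b + e $ j * c) / e $ k"
      using ne by (auto simp: w_def)
    then show ?thesis
      using k by (intro exI[of _ w]) (auto simp: X_def X'_def)
  qed
  have "inj (\<lambda>t. {w. X w + t * X' w = 0})"
  proof (rule injI)
    fix s t assume st: "{w. X w + s * X' w = 0} = {w. X w + t * X' w = 0}"
    obtain w where w: "X w = - s" "X' w = 1"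
      using surj by blast
    then have "w \<in> {w. X w + s * X' w = 0}" by simp
    then have "w \<in> {w. X w + t * X' w = 0}" using st by simp
    then show "s = t" using w by simp
  qed
  then have "infinite (range (\<lambda>t. {w. X w + t * X' w = 0}))"
    using infinite_UNIV_char_0 finite_imageD by blast
  then obtain t where t: "{w. X w + t * X' w = 0} \<notin> A"
    using assms(2) finite_subset by (metis (no_types, lifting) image_subsetI)
  define X0 where "X0 w = X w + t * X' w" for w
  have "plane_coords X0 X' (\<lambda>w. w $ k)"
  proof
    show "X0 (s *s w) = s * X0 w" "X' (s *s w) = s * X' w" "(s *s w) $ k = s * w $ k" for s w
      by (simp_all add: X0_def X_def X'_def algebra_simps)
    show "w = w'" if "X0 w = X0 w'" "X' w = X' w'" "w $ k = w' $ k" for w w'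
    proof -
      have "X w = X w'"
        using that by (simp add: X0_def)
      then have "w $ i = w' $ i" "w $ j = w' $ j"
        using that k by (simp_all add: X_def X'_def)
      then show ?thesis
        using that(3) by (simp add: vec_eq_iff all)
    qed
    show "\<exists>w. X0 w = a \<and> X' w = b \<and> w $ k = c" for a b c
    proof -
      obtain w where "X w = a - t * b" "X' w = b" "w $ k = c"
        using surj by blast
      then show ?thesis
        by (intro exI[of _ w]) (simp add: X0_def)
    qed
    fix L assume "proj_line L"
    then obtain n where n: "n \<noteq> 0" "L = {w. (\<Sum>l\<in>UNIV. n $ l * w $ l) = 0}"
      by (rule proj_line_equation)
    \<comment> \<open>Coefficients of \<open>e $ k\<close> times the equation of \<open>L\<close>,
      after substituting \<open>e $ k * w $ i = X w + e $ i * w $ k\<close>, likewise for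
      \<open>j\<close>, and \<open>X w = X0 w - t * X' w\<close>.\<close>
    define \<alpha> where "\<alpha> = n $ i"
    define \<beta> where "\<beta> = n $ j - t * n $ i"
    define \<gamma> where "\<gamma> = n $ i * e $ i + n $ j * e $ j + n $ k * e $ k"
    have eq: "e $ k * (\<Sum>l\<in>UNIV. n $ l * w $ l) = \<alpha> * X0 w + \<beta> * X' w + \<gamma> * w $ k" for w
      by (simp add: sumU \<alpha>_def \<beta>_def \<gamma>_def X0_def X_def X'_def algebra_simps)
    then have "(\<Sum>l\<in>UNIV. n $ l * w $ l) = 0 \<longleftrightarrow> \<alpha> * X0 w + \<beta> * X' w + \<gamma> * w $ k = 0" for w
      using k by (simp add: eq[symmetric])
    then have "L = {w. \<alpha> * X0 w + \<beta> * X' w + \<gamma> * w $ k = 0}"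
      using n(2) by simp
    moreover have "\<alpha> \<noteq> 0 \<or> \<beta> \<noteq> 0 \<or> \<gamma> \<noteq> 0"
    proof (rule ccontr)
      assume "\<not> (\<alpha> \<noteq> 0 \<or> \<beta> \<noteq> 0 \<or> \<gamma> \<noteq> 0)"
      then have "n $ i = 0" "n $ j = 0" "n $ k = 0"
        using k by (auto simp: \<alpha>_def \<beta>_def \<gamma>_def)
      then have "n = 0" by (simp add: vec_eq_iff all)
      then show False using n(1) by simp
    qed
    ultimately show "\<exists>\<alpha> \<beta> \<gamma>. (\<alpha> \<noteq> 0 \<or> \<beta> \<noteq> 0 \<or> \<gamma> \<noteq> 0) \<and> L = {w. \<alpha> * X0 w + \<beta> * X' w + \<gamma> * w $ k = 0}"
      by blast
  qed
  moreover have "p = {w. X0 w = 0 \<and> X' w = 0}"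
  proof (intro set_eqI iffI)
    fix w assume "w \<in> p"
    then show "w \<in> {w. X0 w = 0 \<and> X' w = 0}"
      by (auto simp: e(2) X0_def X_def X'_def)
  next
    fix w assume "w \<in> {w. X0 w = 0 \<and> X' w = 0}"
    then have "X w = 0" "X' w = 0"
      by (auto simp: X0_def)
    then have "w = (w $ k / e $ k) *s e"
      using k by (simp add: vec_eq_iff all X_def X'_def field_simps)
    then show "w \<in> p"
      unfolding e(2) by blast
  qed
  moreover have "{w. X0 w = 0} \<notin> A"
    using t by (simp add: X0_def)
  ultimately show ?thesis using that by blast
qed

section \<open>Translating the arrangement into the directions \<open>I\<close> and the lines
  \<open>S\<close>\<close>

lemma intersection_point_two_lines:
  assumes "finite A" "q \<in> intersection_points A"
  obtains L M where "L \<in> A" "M \<in> A" "L \<noteq> M" "q \<subseteq> L" "q \<subseteq> M"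
proof -
  have "\<not> card {L \<in> A. q \<subseteq> L} \<le> Suc 0"
    using assms(2) by (simp add: intersection_points_def point_mult_def)
  then show ?thesis
    using assms(1) that by (subst (asm) card_le_Suc0_iff_eq) auto
qed

text \<open>Each double point is the intersection of two lines of \<open>A\<close>. Finiteness makes
  the later lower bound on \<open>card\<close> meaningful, as \<open>card\<close> is 0 on infinite
  sets.\<close>

lemma finite_double_points:
  assumes "line_arrangement A"
  shows "finite (double_points A)"
proof (rule finite_subset)
  show "double_points A \<subseteq> (\<lambda>(L, M). L \<inter> M) ` (A \<times> A)"
  proof
    fix q assume "q \<in> double_points A"
    then have q: "q \<in> intersection_points A" "proj_point q"
      by (auto simp: double_points_def intersection_points_def)
    then obtain L M where "L \<in> A" "M \<in> A" "L \<noteq> M" "q \<subseteq> L" "q \<subseteq> M"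
      using intersection_point_two_lines assms by (metis line_arrangement_def)
    moreover from this have "q = L \<inter> M"
      using assms q(2) by (intro proj_point_eq_inter) (auto simp: line_arrangement_def)
    ultimately show "q \<in> (\<lambda>(L, M). L \<inter> M) ` (A \<times> A)" by auto
  qed
  show "finite ((\<lambda>(L, M). L \<inter> M) ` (A \<times> A))"
    using assms by (simp add: line_arrangement_def)
qed

context plane_coords
begin

context
  fixes A I S
  assumes arr: "line_arrangement A" and inf: "{w. X0 w = 0} \<notin> A"
    and I_def: "I = {a. vline a \<in> A}" and S_def: "S = {j. hline j \<in> A}"
begin

lemma arrangement_eq: "A = vline ` I \<union> hline ` S"
proof
  show "A \<subseteq> vline ` I \<union> hline ` S"
  proof
    fix L assume "L \<in> A"
    then have "proj_line L" "L \<noteq> {w. X0 w = 0}"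
      using arr inf by (auto simp: line_arrangement_def)
    then show "L \<in> vline ` I \<union> hline ` S"
      using \<open>L \<in> A\<close> by (cases rule: line_cases) (auto simp: I_def S_def)
  qed
qed (auto simp: I_def S_def)

lemma finite_parts: "finite I" "finite S"
proof -
  have "finite A"
    using arr by (simp add: line_arrangement_def)
  then have "finite (vline ` I)" "finite (hline ` S)"
    using arrangement_eq by (metis finite_Un)+
  then show "finite I" "finite S"
    by (auto elim!: finite_imageD simp: inj_on_def vline_inject hline_inject)
qed

lemma card_arrangement: "card A = card I + card S"
proof -
  have "card A = card (vline ` I) + card (hline ` S)"
    unfolding arrangement_eq using finite_parts vline_neq_hline by (intro card_Un_disjoint) auto
  then show ?thesis
    by (simp add: card_image inj_on_def vline_inject hline_inject)
qed

lemma point_mult_center: "point_mult A center = card I"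
proof -
  have "{L \<in> A. center \<subseteq> L} = vline ` I"
    using arrangement_eq center_subset_vline not_center_subset_hline by auto
  then show ?thesis
    by (simp add: point_mult_def card_image inj_on_def vline_inject)
qed

lemma point_mult_pt:
  assumes "a \<in> I"
  shows "point_mult A (pt a c) = Suc (card {j \<in> S. ht a j = c})"
proof -
  have "{L \<in> A. pt a c \<subseteq> L} = insert (vline a) (hline ` {j \<in> S. ht a j = c})"
  proof (intro set_eqI iffI)
    fix L assume "L \<in> {L \<in> A. pt a c \<subseteq> L}"
    then show "L \<in> insert (vline a) (hline ` {j \<in> S. ht a j = c})"
      using arrangement_eq by (auto simp: pt_subset_vline pt_subset_hline)
  next
    fix L assume "L \<in> insert (vline a) (hline ` {j \<in> S. ht a j = c})"
    moreover have "pt a c \<subseteq> vline a" "pt a (ht a j) \<subseteq> hline j" for j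
      by (simp_all add: pt_subset_vline pt_subset_hline)
    ultimately show "L \<in> {L \<in> A. pt a c \<subseteq> L}"
      using assms by (auto simp: I_def S_def)
  qed
  moreover have "vline a \<notin> hline ` {j \<in> S. ht a j = c}"
    using vline_neq_hline by auto
  moreover have "card (hline ` {j \<in> S. ht a j = c}) = card {j \<in> S. ht a j = c}"
    by (simp add: card_image inj_on_def hline_inject)
  ultimately show ?thesis
    using finite_parts by (simp add: point_mult_def)
qed

text \<open>The join of the center with a common point of two graphs lies in \<open>A\<close> and
  passes through the center, so it is a vertical line over \<open>I\<close>. This also rules out a
  common point at infinity.\<close>

lemma meets_over_if_modular:
  assumes "modular_point A center"
  shows "meets_over I S"
  unfolding meets_over_def
proof (intro ballI impI)
  fix j k assume jk: "j \<in> S" "k \<in> S" "j \<noteq> k"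
  have fin: "finite A"
    using arr by (simp add: line_arrangement_def)
  have vl: "\<exists>b\<in>I. q \<subseteq> vline b"
    if q: "proj_point q" "q \<subseteq> hline j" "q \<subseteq> hline k" "q \<noteq> center" for q
  proof -
    have "card {hline j, hline k} \<le> card {L \<in> A. q \<subseteq> L}"
      using jk q fin by (intro card_mono) (auto simp: S_def)
    then have "q \<in> intersection_points A"
      using jk(3) q(1) by (simp add: intersection_points_def point_mult_def hline_inject)
    then have join: "proj_join center q \<in> A"
      using assms q(4) by (auto simp: modular_point_def)
    have sub: "center \<subseteq> proj_join center q" "q \<subseteq> proj_join center q"
      using vec.span_superset[of "center \<union> q"] by (auto simp: proj_join_def)
    obtain b where "b \<in> I" "proj_join center q = vline b"
      using join sub(1) arrangement_eq not_center_subset_hline by auto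
    then show ?thesis using sub(2) by auto
  qed
  from jk(3) show "\<exists>a\<in>I. ht a j = ht a k"
  proof (cases rule: hlines_meet)
    case (1 a)
    then obtain b where "b \<in> I" "pt a (ht a j) \<subseteq> vline b"
      using vl[of "pt a (ht a j)"] by (auto simp: proj_point_pt pt_subset_hline pt_neq_center)
    then show ?thesis
      using 1 by (auto simp: pt_subset_vline)
  next
    case (2 q)
    then show ?thesis using vl[of q] by blast
  qed
qed

text \<open>Every line of \<open>A\<close> that misses \<open>pt a c\<close> is vertical. Thus
  another intersection point lies on a line of \<open>A\<close> through \<open>pt a c\<close>, or on
  two vertical lines, in which case it is the center and \<open>vline a\<close> is the join.\<close>

lemma modular_if_all_meet:
  assumes "proj_point center" "a \<in> I" "S \<noteq> {}" "\<And>j. j \<in> S \<Longrightarrow> ht a j = c"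
  shows "modular_point A (pt a c)"
  unfolding modular_point_def
proof (intro conjI ballI impI)
  have lines: "proj_line L" if "L \<in> A" for L
    using arr that by (simp add: line_arrangement_def)
  have "{j \<in> S. ht a j = c} = S"
    using assms(4) by blast
  then show "pt a c \<in> intersection_points A"
    using point_mult_pt[OF assms(2), of c] assms(3) finite_parts(2)
    by (simp add: intersection_points_def proj_point_pt Suc_le_eq card_gt_0_iff)
  fix r assume r: "r \<in> intersection_points A" "r \<noteq> pt a c"
  then have pr: "proj_point r"
    by (simp add: intersection_points_def)
  have "finite A"
    using arr by (simp add: line_arrangement_def)
  then obtain L M where LM: "L \<in> A" "M \<in> A" "L \<noteq> M" "r \<subseteq> L" "r \<subseteq> M"
    using intersection_point_two_lines r(1) by blast
  have "\<exists>N\<in>A. pt a c \<subseteq> N \<and> r \<subseteq> N"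
  proof (cases "pt a c \<subseteq> L \<or> pt a c \<subseteq> M")
    case True
    then show ?thesis using LM by blast
  next
    case False
    have "center \<subseteq> N" if "N \<in> A" "\<not> pt a c \<subseteq> N" for N
    proof -
      have "N \<notin> hline ` S"
        using that(2) assms(4) pt_subset_hline by blast
      then show ?thesis
        using that(1) arrangement_eq center_subset_vline by blast
    qed
    then have "center \<subseteq> L" "center \<subseteq> M"
      using False LM by blast+
    then have "r = center"
      using proj_point_eq_inter[OF lines[OF LM(1)] lines[OF LM(2)] LM(3)] assms(1) pr LM(4,5) by metis
    moreover have "vline a \<in> A"
      using assms(2) by (simp add: I_def)
    moreover have "pt a c \<subseteq> vline a"
      by (simp add: pt_subset_vline)
    ultimately show ?thesis
      using center_subset_vline[of a] by blast
  qed
  then obtain N where "N \<in> A" "pt a c \<subseteq> N" "r \<subseteq> N" by blast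
  moreover from this have "proj_join (pt a c) r = N"
    using r(2) pr lines by (intro proj_join_eq) (auto simp: proj_point_pt)
  ultimately show "proj_join (pt a c) r \<in> A" by simp
qed

text \<open>A line alone over \<open>a\<close> meets \<open>vline a\<close> in a point of
  multiplicity 2, and distinct pairs \<open>(a, j)\<close> yield distinct points.\<close>

lemma sum_card_singles_le_double_points: "(\<Sum>a\<in>I. card (singles S a)) \<le> card (double_points A)"
proof -
  let ?D = "SIGMA a:I. singles S a" and ?f = "\<lambda>(a, j). pt a (ht a j)"
  have fin: "finite (singles S a)" for a
    using finite_parts(2) by (simp add: singles_def)
  have "inj_on ?f ?D"
  proof (rule inj_onI, clarsimp simp: pt_inject)
    fix a u v u' v' assume "(u, v) \<in> singles S a" "(u', v') \<in> singles S a" "ht a (u, v) = ht a (u', v')"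
    then have "(u, v) \<in> block S a (u, v)" "(u', v') \<in> block S a (u, v)" "card (block S a (u, v)) = 1"
      by (auto simp: singles_def block_def)
    then have "(u, v) = (u', v')"
      by (metis card_1_singletonE singletonD)
    then show "u = u' \<and> v = v'" by simp
  qed
  then have "(\<Sum>a\<in>I. card (singles S a)) = card (?f ` ?D)"
    using finite_parts(1) fin by (simp add: card_image)
  also have "\<dots> \<le> card (double_points A)"
  proof (intro card_mono finite_double_points[OF arr] subsetI)
    fix q assume "q \<in> ?f ` ?D"
    then obtain a j where q: "q = pt a (ht a j)" "a \<in> I" "j \<in> singles S a" by auto
    then have "point_mult A q = 2"
      by (simp add: point_mult_pt singles_def block_def)
    then show "q \<in> double_points A"
      using q(1) by (simp add: double_points_def intersection_points_def proj_point_pt)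
  qed
  finally show ?thesis .
qed

end

end

theorem corollary1p11:
  fixes m :: nat and A :: "(complex ^ 3) set set"
  assumes "3 \<le> m" and "m \<le> 5"
    and "line_arrangement A"
    and "homogeneous_supersolvable m A"
    and "\<not> pencil A"
  shows "real (card (double_points A)) \<ge> real (card A) / 2"
proof -
  obtain p where p: "modular_point A p" "point_mult A p = m"
    using assms(4) by (auto simp: homogeneous_supersolvable_def supersolvable_def)
  have pp: "proj_point p"
    using p(1) by (simp add: modular_point_def intersection_points_def)
  have "finite A"
    using assms(3) by (simp add: line_arrangement_def)
  then obtain X0 X1 Y where coords: "plane_coords X0 X1 Y"
      and p_eq: "p = {w. X0 w = 0 \<and> X1 w = 0}" and inf: "{w. X0 w = 0} \<notin> A"
    using plane_coords_exist[OF pp] by blast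
  interpret plane_coords X0 X1 Y by fact
  have center: "center = p"
    by (simp add: center_def p_eq)
  define I where "I = {a. vline a \<in> A}"
  define S where "S = {j. hline j \<in> A}"
  note arr = assms(3) inf I_def S_def
  note fin = finite_parts[OF arr]
  have cardI: "card I = m"
    using point_mult_center[OF arr] center p(2) by simp
  have meets: "meets_over I S"
    using meets_over_if_modular[OF arr] center p(1) by simp
  have S_ne: "S \<noteq> {}"
  proof
    assume "S = {}"
    then have "\<forall>L\<in>A. p \<subseteq> L"
      using arrangement_eq[OF arr] center_subset_vline center by auto
    then show False
      using assms(5) pp unfolding pencil_def by blast
  qed
  \<comment> \<open>If all of \<open>S\<close> passed through one point over \<open>a\<close>, that
    point would be modular of multiplicity \<open>card S + 1 > m\<close>, contradicting
    homogeneity.\<close>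
  have split: "card (ht a ` S) \<ge> 2" if "card S > card I" "a \<in> I" for a
  proof (rule ccontr)
    assume "\<not> card (ht a ` S) \<ge> 2"
    then have "card (ht a ` S) \<le> Suc 0" by simp
    then have eq: "\<forall>x\<in>ht a ` S. \<forall>y\<in>ht a ` S. x = y"
      using card_le_Suc0_iff_eq[of "ht a ` S"] fin(2) by blast
    obtain j0 where j0: "j0 \<in> S"
      using S_ne by blast
    have all: "ht a j = ht a j0" if "j \<in> S" for j
      using eq j0 that by blast
    then have "modular_point A (pt a (ht a j0))"
      using modular_if_all_meet[OF arr _ that(2) S_ne] center pp by simp
    then have "point_mult A (pt a (ht a j0)) = m"
      using assms(4) by (simp add: homogeneous_supersolvable_def)
    moreover have "{j \<in> S. ht a j = ht a j0} = S"
      using all by blast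
    ultimately show False
      using point_mult_pt[OF arr that(2), of "ht a j0"] that(1) cardI by simp
  qed
  have "card A = card I + card S"
    by (rule card_arrangement[OF arr])
  also have "\<dots> \<le> 2 * (\<Sum>a\<in>I. card (singles S a))"
    using many_singles[OF fin(2,1) meets S_ne] split cardI assms(1,2) by simp
  also have "\<dots> \<le> 2 * card (double_points A)"
    using sum_card_singles_le_double_points[OF arr] by simp
  finally show ?thesis by simp
qed

end
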